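(* Let $\mathsf{PDL}$ be the variety of pseudocomplemented distributive lattices and $\boldsymbol{F}_{\mathsf{PDL}}(\aleph_0)$ its free algebra on countably infinitely many free generators. The universal theory $\mathsf{Th}_\forall(\boldsymbol{F}_{\mathsf{PDL}}(\aleph_0))$ is axiomatized (relative to $\mathsf{PDL}$) by the set $\Sigma$ of universal sentences defined in the context; that is, for every pseudocomplemented distributive lattice $\boldsymbol{A}$, $\boldsymbol{A}$ is a model of $\mathsf{Th}_\forall(\boldsymbol{F}_{\mathsf{PDL}}(\aleph_0))$ if and only if $\boldsymbol{A}\vDash\Sigma$.
   Context: A pseudocomplemented distributive lattice is an algebra $\langle A;\wedge,\vee,\neg,0,1\rangle$ with $\langle A;\wedge,\vee,0,1\rangle$ a bounded distributive lattice and $a\leq\neg b\iff a\wedge b=0$ for all $a,b$. $\mathsf{Th}_\forall(\boldsymbol{A})$ is the set of universal sentences ($\forall\vec{x}\,P$ with $P$ quantifier-free) valid in $\boldsymbol{A}$. First-order implication, conjunction and disjunction are written $\Rightarrow,\sqcap,\sqcup$ (indexed versions $\mathop{\sqcap}_{i},\bigsqcup_{i}$), to distinguish them from the lattice operations; for terms, $s\leq t$ abbreviates $s\wedge t\approx s$. Empty meets and joins of terms are $1$ and $0$. $\wp(n)$ is the powerset of $\{1,\dots,n\}$. For $\vec{x}=\langle x_1,\dots,x_n\rangle$ and $T\in\wp(n)$ let $a_T(\vec{x})=\bigwedge_{i\in T}x_i\wedge\bigwedge_{i\notin T}\neg x_i$, with $i$ ranging over $\{1,\dots,n\}$. Let $$\mathcal{S}(n)=\{\langle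 L,\mathcal{T}\rangle: L\in\wp(n),\ \mathcal{T}\subseteq\wp(n),\text{ and }\varnothing\neq L\subseteq\bigcap\mathcal{T}\},$$ partially ordered by $\langle L,\mathcal{T}\rangle\leq\langle L',\mathcal{T}'\rangle\iff L\supseteq L'$ and $\mathcal{T}\subseteq\mathcal{T}'$. For $\langle L,\mathcal{T}\rangle\in\mathcal{S}(n)$ let $p_L^{\mathcal{T}}(\vec{x})=\bigwedge_{i\in L}x_i\wedge\neg\neg\bigl(\bigvee_{T\in\mathcal{T}}a_T(\vec{x})\bigr)$. For $n\in\mathbb{Z}^+$ and a term $t=t(x_1,\dots,x_n)$ let $$\mathsf{At}_{t,n}(\vec{x})= t\not\approx 0\ \sqcap\bigsqcup_{T\in\wp(n)}t\approx a_T(\vec{x}),$$ $$\mathsf{Jirr}_{t,n}(\vec{x})=\bigsqcup_{\langle L,\mathcal{T}\rangle\in\mathcal{S}(n)}\Bigl(t\approx p_L^{\mathcal{T}}(\vec{x})\ \sqcap\ t\not\approx\bigvee\{p_{L'}^{\mathcal{T}'}(\vec{x}):\langle L',\mathcal{T}'\rangle\in\mathcal{S}(n)\text{ and }\langle L',\mathcal{T}'\rangle<\langle L,\mathcal{T}\rangle\}\Bigr).$$ For disjoint tuples of variables $\vec{x}=\langle x_1,\dots,x_n\rangle$, $\vec{y}=\langle y_1,\dots,y_m\rangle$, $\vec{z}=\langle z_1,\dots,z_k\rangle$ (a term or formula applied to $\vec{x},\vec{y}$ is applied to the concatenated tuple), and quantifier-free formulas $P(\vec{x},\vec{y})$, $Q(\vec{x},\vec{y},\vec{z})$,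 let $F_{n,m,k}(\vec{x},\vec{y})$ be the formula $A\Rightarrow B$ with $$A=\mathsf{Jirr}_{x_1,n+m}(\vec{x},\vec{y})\sqcap\mathop{\sqcap}_{i=1}^m\mathsf{At}_{y_i,n+m}(\vec{x},\vec{y})\sqcap P(\vec{x},\vec{y}),$$ $$B=\bigsqcup_{\langle\langle L_1,\mathcal{T}_1\rangle,\dots,\langle L_k,\mathcal{T}_k\rangle\rangle\in\mathcal{S}(n+m)^k}\Bigl(Q(\vec{x},\vec{y},p_1,\dots,p_k)\sqcap\mathop{\sqcap}_{j=1}^k\mathsf{Jirr}_{p_j,n+m}(\vec{x},\vec{y})\Bigr),\qquad p_j=p_{L_j}^{\mathcal{T}_j}(\vec{x},\vec{y}).$$ For $1\leq h\leq m$ let $$P_{n,m,h}(\vec{x},\vec{y})=\mathop{\sqcap}_{i=1}^h y_i\leq x_1\ \sqcap\mathop{\sqcap}_{j=h+1}^m y_j\nleq x_1 .$$ For each $h\geq1$ fix a bijection $f:\{1,\dots,2^h-1\}\to\wp(h)\setminus\{\varnothing\}$, and for $\vec{z}=\langle z_1,\dots,z_{2^h-1}\rangle$ disjoint from $\vec{x}$ and $\vec{y}$ let $Q_{n,m,h}(\vec{x},\vec{y},\vec{z})$ be the conjunction of: $z_i\leq x_1$ for all $i\leq 2^h-1$; $z_i\leq z_j$ for all $i,j\leq 2^h-1$ with $f(i)\subseteq f(j)$; $y_j\leq z_i$ for all $i\leq 2^h-1$, $j\leq m$ with $j\in f(i)$; $y_j\nleq z_i$ for all $i\leq 2^h-1$,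 $j\leq m$ with $j\notin f(i)$. Let $\mathrm{FS}_{n,m,2^h-1}(\vec{x},\vec{y})$ be the formula $F_{n,m,2^h-1}(\vec{x},\vec{y})$ obtained from $P=P_{n,m,h}$ and $Q=Q_{n,m,h}$ (with $k=2^h-1$). Let $\mathrm{DN}(x,y,z)$ be $\neg\neg x= y\vee z\Rightarrow(y=\neg\neg x\sqcup z=\neg\neg x)$. Then $\Sigma$ is the set of universal closures of the formulas $0\not\approx1$, $\mathrm{DN}(x,y,z)$, and $\mathrm{FS}_{n,m,2^h-1}(\vec{x},\vec{y})$ for all $n,m,h\in\mathbb{Z}^+$ with $h\leq m$.
   Formalization: P_{n,m,h} is taken with the extra conjuncts that y_1,…,y_h are pairwise distinct; as printed, x_1=y_1=y_2=1 with n=1, m=h=2 falsifies FS in every nontrivial algebra, so the printed Σ has no model. *)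

theory Defs
  imports Main
begin

section \<open>Pseudocomplemented distributive lattices\<close>

class pdl = distrib_lattice + bounded_lattice + uminus +
  assumes le_uminus_iff: "a \<le> - b \<longleftrightarrow> inf a b = bot"


section \<open>Terms, formulas and universal sentences\<close>

datatype trm = Var nat | Zero | One | Meet trm trm | Join trm trm | Neg trm

datatype fm =
    EQ trm trm | NOT fm | AND fm fm | OR fm fm | IMP fm fm | FORALL nat fm

primrec tval :: "(nat \<Rightarrow> 'a::pdl) \<Rightarrow> trm \<Rightarrow> 'a" where
  "tval e (Var i) = e i"
| "tval e Zero = bot"
| "tval e One = top"
| "tval e (Meet s t) = inf (tval e s) (tval e t)"
| "tval e (Join s t) = sup (tval e s) (tval e t)"
| "tval e (Neg t) = - tval e t"

primrec sat :: "(nat \<Rightarrow> 'a::pdl) \<Rightarrow> fm \<Rightarrow> bool" where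
  "sat e (EQ s t) \<longleftrightarrow> tval e s = tval e t"
| "sat e (NOT \<phi>) \<longleftrightarrow> \<not> sat e \<phi>"
| "sat e (AND \<phi> \<psi>) \<longleftrightarrow> sat e \<phi> \<and> sat e \<psi>"
| "sat e (OR \<phi> \<psi>) \<longleftrightarrow> sat e \<phi> \<or> sat e \<psi>"
| "sat e (IMP \<phi> \<psi>) \<longleftrightarrow> (sat e \<phi> \<longrightarrow> sat e \<psi>)"
| "sat e (FORALL i \<phi>) \<longleftrightarrow> (\<forall>a. sat (e(i := a)) \<phi>)"

primrec tvars :: "trm \<Rightarrow> nat set" where
  "tvars (Var i) = {i}"
| "tvars Zero = {}"
| "tvars One = {}"
| "tvars (Meet s t) = tvars s \<union> tvars t"
| "tvars (Join s t) = tvars s \<union> tvars t"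
| "tvars (Neg t) = tvars t"

primrec fvars :: "fm \<Rightarrow> nat set" where
  "fvars (EQ s t) = tvars s \<union> tvars t"
| "fvars (NOT \<phi>) = fvars \<phi>"
| "fvars (AND \<phi> \<psi>) = fvars \<phi> \<union> fvars \<psi>"
| "fvars (OR \<phi> \<psi>) = fvars \<phi> \<union> fvars \<psi>"
| "fvars (IMP \<phi> \<psi>) = fvars \<phi> \<union> fvars \<psi>"
| "fvars (FORALL i \<phi>) = fvars \<phi> - {i}"

primrec qfree :: "fm \<Rightarrow> bool" where
  "qfree (EQ s t) \<longleftrightarrow> True"
| "qfree (NOT \<phi>) \<longleftrightarrow> qfree \<phi>"
| "qfree (AND \<phi> \<psi>) \<longleftrightarrow> qfree \<phi> \<and> qfree \<psi>"
| "qfree (OR \<phi> \<psi>) \<longleftrightarrow> qfree \<phi> \<and> qfree \<psi>"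
| "qfree (IMP \<phi> \<psi>) \<longleftrightarrow> qfree \<phi> \<and> qfree \<psi>"
| "qfree (FORALL i \<phi>) \<longleftrightarrow> False"

definition foralls :: "nat list \<Rightarrow> fm \<Rightarrow> fm" where
  "foralls is \<phi> = foldr FORALL is \<phi>"

definition universal_sentence :: "fm \<Rightarrow> bool" where
  "universal_sentence \<phi> \<longleftrightarrow> (\<exists>is P. qfree P \<and> \<phi> = foralls is P) \<and> fvars \<phi> = {}"

definition universal_closure :: "fm \<Rightarrow> fm" where
  "universal_closure \<phi> = foralls (sorted_list_of_set (fvars \<phi>)) \<phi>"

definition models :: "'a::pdl itself \<Rightarrow> fm \<Rightarrow> bool" where
  "models A \<phi> \<longleftrightarrow> (\<forall>e :: nat \<Rightarrow> 'a. sat e \<phi>)"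

definition models_set :: "'a::pdl itself \<Rightarrow> fm set \<Rightarrow> bool" where
  "models_set A \<Gamma> \<longleftrightarrow> (\<forall>\<phi>\<in>\<Gamma>. models A \<phi>)"

definition Th_univ :: "'a::pdl itself \<Rightarrow> fm set" where
  "Th_univ A = {\<phi>. universal_sentence \<phi> \<and> models A \<phi>}"

lemma sat_foralls:
  "(\<forall>e :: nat \<Rightarrow> 'a::pdl. sat e (foralls is \<phi>)) \<longleftrightarrow> (\<forall>e :: nat \<Rightarrow> 'a. sat e \<phi>)"
proof (induction "is")
  case Nil
  show ?case by (simp add: foralls_def)
next
  case (Cons i "is")
  have "(\<forall>e :: nat \<Rightarrow> 'a. sat e (foralls (i # is) \<phi>)) \<longleftrightarrow>
      (\<forall>e :: nat \<Rightarrow> 'a. sat e (foralls is \<phi>))"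
    by (simp add: foralls_def) (metis fun_upd_triv)
  with Cons show ?case by simp
qed

lemma models_universal_closure:
  "models TYPE('a::pdl) (universal_closure \<phi>) \<longleftrightarrow> (\<forall>e :: nat \<Rightarrow> 'a. sat e \<phi>)"
  by (simp add: models_def universal_closure_def sat_foralls)


section \<open>The free algebra on countably many generators\<close>

text \<open>The quotient of the term algebra by its least congruence whose quotient is a
  pseudocomplemented distributive lattice; the universal property is
  \<open>free_pdl_universal\<close> below.\<close>

inductive pdl_eq :: "trm \<Rightarrow> trm \<Rightarrow> bool" where
  refl: "pdl_eq s s"
| sym: "pdl_eq s t \<Longrightarrow> pdl_eq t s"
| trans: "pdl_eq s t \<Longrightarrow> pdl_eq t u \<Longrightarrow> pdl_eq s u"
| cong_Meet: "pdl_eq s s' \<Longrightarrow> pdl_eq t t' \<Longrightarrow> pdl_eq (Meet s t) (Meet s' t')"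
| cong_Join: "pdl_eq s s' \<Longrightarrow> pdl_eq t t' \<Longrightarrow> pdl_eq (Join s t) (Join s' t')"
| cong_Neg: "pdl_eq s s' \<Longrightarrow> pdl_eq (Neg s) (Neg s')"
| Meet_comm: "pdl_eq (Meet s t) (Meet t s)"
| Meet_assoc: "pdl_eq (Meet (Meet s t) u) (Meet s (Meet t u))"
| Join_comm: "pdl_eq (Join s t) (Join t s)"
| Join_assoc: "pdl_eq (Join (Join s t) u) (Join s (Join t u))"
| Meet_absorb: "pdl_eq (Meet s (Join s t)) s"
| Join_absorb: "pdl_eq (Join s (Meet s t)) s"
| distrib: "pdl_eq (Join s (Meet t u)) (Meet (Join s t) (Join s u))"
| Zero: "pdl_eq (Meet Zero s) Zero"
| One: "pdl_eq (Meet s One) s"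
| pc1: "pdl_eq (Meet s (Neg t)) s \<Longrightarrow> pdl_eq (Meet s t) Zero"
| pc2: "pdl_eq (Meet s t) Zero \<Longrightarrow> pdl_eq (Meet s (Neg t)) s"

quotient_type free_pdl = trm / pdl_eq
  by (intro equivpI reflpI sympI transpI) (blast intro: pdl_eq.intros)+

instantiation free_pdl :: pdl
begin

lift_definition inf_free_pdl :: "free_pdl \<Rightarrow> free_pdl \<Rightarrow> free_pdl" is Meet
  by (rule cong_Meet)
lift_definition sup_free_pdl :: "free_pdl \<Rightarrow> free_pdl \<Rightarrow> free_pdl" is Join
  by (rule cong_Join)
lift_definition uminus_free_pdl :: "free_pdl \<Rightarrow> free_pdl" is Neg
  by (rule cong_Neg)
lift_definition bot_free_pdl :: free_pdl is Zero .
lift_definition top_free_pdl :: free_pdl is One .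

definition less_eq_free_pdl :: "free_pdl \<Rightarrow> free_pdl \<Rightarrow> bool" where
  "less_eq_free_pdl a b \<longleftrightarrow> inf a b = a"
definition less_free_pdl :: "free_pdl \<Rightarrow> free_pdl \<Rightarrow> bool" where
  "less_free_pdl a b \<longleftrightarrow> a \<le> b \<and> \<not> b \<le> a"

instance
proof
  have comm: "inf a b = inf b a" for a b :: free_pdl
    by transfer (rule Meet_comm)
  have assoc: "inf (inf a b) c = inf a (inf b c)" for a b c :: free_pdl
    by transfer (rule Meet_assoc)
  have jcomm: "sup a b = sup b a" for a b :: free_pdl
    by transfer (rule Join_comm)
  have jassoc: "sup (sup a b) c = sup a (sup b c)" for a b c :: free_pdl
    by transfer (rule Join_assoc)
  have ab: "inf a (sup a b) = a" for a b :: free_pdl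
    by transfer (rule Meet_absorb)
  have jab: "sup a (inf a b) = a" for a b :: free_pdl
    by transfer (rule Join_absorb)
  have idem: "inf a a = a" for a :: free_pdl
    by (metis ab jab)
  fix a b c :: free_pdl
  show "a < b \<longleftrightarrow> a \<le> b \<and> \<not> b \<le> a" by (rule less_free_pdl_def)
  show "a \<le> a" by (simp add: less_eq_free_pdl_def idem)
  show "a \<le> b \<Longrightarrow> b \<le> c \<Longrightarrow> a \<le> c" unfolding less_eq_free_pdl_def by (metis assoc)
  show "a \<le> b \<Longrightarrow> b \<le> a \<Longrightarrow> a = b" unfolding less_eq_free_pdl_def by (metis comm)
  show "inf a b \<le> a" unfolding less_eq_free_pdl_def by (metis assoc comm idem)
  show "inf a b \<le> b" unfolding less_eq_free_pdl_def by (metis assoc idem)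
  show "a \<le> b \<Longrightarrow> a \<le> c \<Longrightarrow> a \<le> inf b c" unfolding less_eq_free_pdl_def by (metis assoc)
  have le_sup: "x \<le> y \<longleftrightarrow> sup x y = y" for x y :: free_pdl
    unfolding less_eq_free_pdl_def by (metis ab comm jab jcomm)
  show "a \<le> sup a b" by (simp add: less_eq_free_pdl_def ab)
  show "b \<le> sup a b" by (metis less_eq_free_pdl_def ab jcomm)
  show "b \<le> a \<Longrightarrow> c \<le> a \<Longrightarrow> sup b c \<le> a" unfolding le_sup by (metis jassoc)
  show "sup a (inf b c) = inf (sup a b) (sup a c)"
    by transfer (rule distrib)
  show "bot \<le> a" unfolding less_eq_free_pdl_def by transfer (rule pdl_eq.Zero)
  show "a \<le> top" unfolding less_eq_free_pdl_def by transfer (rule pdl_eq.One)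
  show "a \<le> - b \<longleftrightarrow> inf a b = bot"
    unfolding less_eq_free_pdl_def by transfer (blast intro: pc1 pc2)
qed

end

lift_definition gen :: "nat \<Rightarrow> free_pdl" is Var .

definition pdl_hom :: "('a::pdl \<Rightarrow> 'b::pdl) \<Rightarrow> bool" where
  "pdl_hom h \<longleftrightarrow> (\<forall>a b. h (inf a b) = inf (h a) (h b)) \<and> (\<forall>a b. h (sup a b) = sup (h a) (h b)) \<and>
     (\<forall>a. h (- a) = - h a) \<and> h bot = bot \<and> h top = top"

lemma pdl_eq_sound:
  fixes e :: "nat \<Rightarrow> 'a::pdl"
  assumes "pdl_eq s t"
  shows "tval e s = tval e t"
  using assms
proof induction
  case (pc1 s t)
  then show ?case by (metis inf.absorb_iff1 le_uminus_iff tval.simps(2,4,6))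
next
  case (pc2 s t)
  then show ?case by (metis inf.absorb_iff1 le_uminus_iff tval.simps(2,4,6))
qed (auto simp: inf.commute inf.left_commute sup.commute sup.left_commute sup_inf_distrib1)

lemma free_pdl_universal:
  fixes g :: "nat \<Rightarrow> 'a::pdl"
  shows "\<exists>!h. pdl_hom h \<and> (\<forall>i. h (gen i) = g i)"
proof (rule ex_ex1I)
  define h where "h = (\<lambda>a. tval g (rep_free_pdl a))"
  have h: "h (abs_free_pdl t) = tval g t" for t
    unfolding h_def
    by (rule pdl_eq_sound) (simp add: Quotient3_rep_abs[OF Quotient3_free_pdl] refl)
  have "pdl_hom h"
    unfolding pdl_hom_def
  proof (intro conjI allI)
    fix a b
    obtain s t where [simp]: "a = abs_free_pdl s" "b = abs_free_pdl t"
      by (metis Quotient3_abs_rep[OF Quotient3_free_pdl])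
    show "h (inf a b) = inf (h a) (h b)" by (simp add: inf_free_pdl.abs_eq h)
    show "h (sup a b) = sup (h a) (h b)" by (simp add: sup_free_pdl.abs_eq h)
    show "h (- a) = - h a" by (simp add: uminus_free_pdl.abs_eq h)
    show "h bot = bot" by (simp add: bot_free_pdl.abs_eq h)
    show "h top = top" by (simp add: top_free_pdl.abs_eq h)
  qed
  then show "\<exists>h. pdl_hom h \<and> (\<forall>i. h (gen i) = g i)"
    by (auto simp: gen.abs_eq h)
next
  fix h h' :: "free_pdl \<Rightarrow> 'a"
  assume hom: "pdl_hom h \<and> (\<forall>i. h (gen i) = g i)" "pdl_hom h' \<and> (\<forall>i. h' (gen i) = g i)"
  have *: "k (abs_free_pdl t) = tval g t"
    if "pdl_hom k \<and> (\<forall>i. k (gen i) = g i)" for k :: "free_pdl \<Rightarrow> 'a" and t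
  proof (induction t)
    case (Var i)
    show ?case using that by (simp flip: gen.abs_eq)
  qed (use that in \<open>simp_all add: pdl_hom_def flip: inf_free_pdl.abs_eq sup_free_pdl.abs_eq
          uminus_free_pdl.abs_eq bot_free_pdl.abs_eq top_free_pdl.abs_eq\<close>)
  show "h = h'"
  proof
    fix a
    show "h a = h' a"
      using *[OF hom(1), of "rep_free_pdl a"] *[OF hom(2), of "rep_free_pdl a"]
      by (simp add: Quotient3_abs_rep[OF Quotient3_free_pdl])
  qed
qed


section \<open>Finite meets, joins, conjunctions and disjunctions\<close>

text \<open>Syntactic operations indexed by a finite set: the elements are listed in an arbitrary
  order, which is irrelevant up to equivalence.\<close>

definition enum_of :: "'i set \<Rightarrow> 'i list" where
  "enum_of I = (SOME is. distinct is \<and> set is = I)"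

definition Meets :: "'i set \<Rightarrow> ('i \<Rightarrow> trm) \<Rightarrow> trm" where
  "Meets I t = foldr Meet (map t (enum_of I)) One"

definition Joins :: "'i set \<Rightarrow> ('i \<Rightarrow> trm) \<Rightarrow> trm" where
  "Joins I t = foldr Join (map t (enum_of I)) Zero"

definition Conjs :: "'i set \<Rightarrow> ('i \<Rightarrow> fm) \<Rightarrow> fm" where
  "Conjs I \<phi> = foldr AND (map \<phi> (enum_of I)) (EQ Zero Zero)"

definition Disjs :: "'i set \<Rightarrow> ('i \<Rightarrow> fm) \<Rightarrow> fm" where
  "Disjs I \<phi> = foldr OR (map \<phi> (enum_of I)) (NOT (EQ Zero Zero))"

lemma set_enum_of [simp]: "finite I \<Longrightarrow> set (enum_of I) = I"
  unfolding enum_of_def by (rule someI2_ex) (use finite_distinct_list in blast)+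

lemma sat_Conjs: "finite I \<Longrightarrow> sat e (Conjs I \<phi>) \<longleftrightarrow> (\<forall>i\<in>I. sat e (\<phi> i))"
proof -
  have "sat e (foldr AND (map \<phi> is) (EQ Zero Zero)) \<longleftrightarrow> (\<forall>i\<in>set is. sat e (\<phi> i))" for "is"
    by (induction "is") auto
  then show "finite I \<Longrightarrow> ?thesis" by (simp add: Conjs_def)
qed

lemma sat_Disjs: "finite I \<Longrightarrow> sat e (Disjs I \<phi>) \<longleftrightarrow> (\<exists>i\<in>I. sat e (\<phi> i))"
proof -
  have "sat e (foldr OR (map \<phi> is) (NOT (EQ Zero Zero))) \<longleftrightarrow> (\<exists>i\<in>set is. sat e (\<phi> i))" for "is"
    by (induction "is") auto
  then show "finite I \<Longrightarrow> ?thesis" by (simp add: Disjs_def)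
qed

lemma tval_Meets_le_iff: "finite I \<Longrightarrow> a \<le> tval e (Meets I t) \<longleftrightarrow> (\<forall>i\<in>I. a \<le> tval e (t i))"
proof -
  have "a \<le> tval e (foldr Meet (map t is) One) \<longleftrightarrow> (\<forall>i\<in>set is. a \<le> tval e (t i))" for "is"
    by (induction "is") auto
  then show "finite I \<Longrightarrow> ?thesis" by (simp add: Meets_def)
qed

lemma tval_Joins_le_iff: "finite I \<Longrightarrow> tval e (Joins I t) \<le> a \<longleftrightarrow> (\<forall>i\<in>I. tval e (t i) \<le> a)"
proof -
  have "tval e (foldr Join (map t is) Zero) \<le> a \<longleftrightarrow> (\<forall>i\<in>set is. tval e (t i) \<le> a)" for "is"
    by (induction "is") auto
  then show "finite I \<Longrightarrow> ?thesis" by (simp add: Joins_def)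
qed


section \<open>The axioms\<close>

text \<open>Tuples of terms are lists, and \<open>nth1\<close> indexes them from 1. A term or formula applied to
  \<open>\<langle>x\<^sub>1,\<dots>,x\<^sub>n\<rangle>\<close> is a function of such a list, with \<open>n\<close> recovered as its length.\<close>

definition nth1 :: "'b list \<Rightarrow> nat \<Rightarrow> 'b" where
  "nth1 xs i = xs ! (i - 1)"

definition LE :: "trm \<Rightarrow> trm \<Rightarrow> fm" where
  "LE s t = EQ (Meet s t) s"

definition aT :: "trm list \<Rightarrow> nat set \<Rightarrow> trm" where
  "aT xs T = Meet (Meets T (\<lambda>i. nth1 xs i)) (Meets ({1..length xs} - T) (\<lambda>i. Neg (nth1 xs i)))"

definition SS :: "nat \<Rightarrow> (nat set \<times> nat set set) set" where
  "SS n = {(L, \<T>). L \<in> Pow {1..n} \<and> \<T> \<subseteq> Pow {1..n} \<and> L \<noteq> {} \<and> L \<subseteq> \<Inter>\<T>}"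

definition SS_le :: "nat set \<times> nat set set \<Rightarrow> nat set \<times> nat set set \<Rightarrow> bool" where
  "SS_le = (\<lambda>(L, \<T>) (L', \<T>'). L \<supseteq> L' \<and> \<T> \<subseteq> \<T>')"

definition SS_less :: "nat set \<times> nat set set \<Rightarrow> nat set \<times> nat set set \<Rightarrow> bool" where
  "SS_less p q \<longleftrightarrow> SS_le p q \<and> p \<noteq> q"

definition pLT :: "trm list \<Rightarrow> nat set \<times> nat set set \<Rightarrow> trm" where
  "pLT xs = (\<lambda>(L, \<T>). Meet (Meets L (\<lambda>i. nth1 xs i)) (Neg (Neg (Joins \<T> (\<lambda>T. aT xs T)))))"

definition At :: "trm \<Rightarrow> trm list \<Rightarrow> fm" where
  "At t xs = AND (NOT (EQ t Zero)) (Disjs (Pow {1..length xs}) (\<lambda>T. EQ t (aT xs T)))"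

definition Jirr :: "trm \<Rightarrow> trm list \<Rightarrow> fm" where
  "Jirr t xs = Disjs (SS (length xs)) (\<lambda>p.
     AND (EQ t (pLT xs p))
         (NOT (EQ t (Joins {q \<in> SS (length xs). SS_less q p} (\<lambda>q. pLT xs q)))))"

definition FF :: "(trm list \<Rightarrow> trm list \<Rightarrow> fm) \<Rightarrow> (trm list \<Rightarrow> trm list \<Rightarrow> trm list \<Rightarrow> fm) \<Rightarrow>
    nat \<Rightarrow> trm list \<Rightarrow> trm list \<Rightarrow> fm" where
  "FF P Q k xs ys =
     IMP (AND (Jirr (nth1 xs 1) (xs @ ys))
           (AND (Conjs {1..length ys} (\<lambda>i. At (nth1 ys i) (xs @ ys))) (P xs ys)))
         (Disjs {ps. length ps = k \<and> set ps \<subseteq> SS (length xs + length ys)} (\<lambda>ps.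
           AND (Q xs ys (map (pLT (xs @ ys)) ps))
               (Conjs {1..k} (\<lambda>j. Jirr (pLT (xs @ ys) (nth1 ps j)) (xs @ ys)))))"

definition PP0 :: "nat \<Rightarrow> trm list \<Rightarrow> trm list \<Rightarrow> fm" where
  "PP0 h xs ys = AND (Conjs {1..h} (\<lambda>i. LE (nth1 ys i) (nth1 xs 1)))
     (Conjs {h+1..length ys} (\<lambda>j. NOT (LE (nth1 ys j) (nth1 xs 1))))"

text \<open>\<open>PP0\<close> is the formula \<open>P\<^sub>n\<^sub>,\<^sub>m\<^sub>,\<^sub>h\<close> of the paper as printed. It omits the tacit assumption that
  \<open>y\<^sub>1,\<dots>,y\<^sub>h\<close> are distinct, without which the axioms are inconsistent with \<open>0 \<noteq> 1\<close>
  (lemma \<open>FF_PP0_fails\<close> below): if \<open>y\<^sub>1 = y\<^sub>2\<close>, then no \<open>z\<^sub>i\<close> with \<open>f i = {1}\<close> satisfies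
  \<open>y\<^sub>1 \<le> z\<^sub>i\<close> and \<open>\<not> y\<^sub>2 \<le> z\<^sub>i\<close>. The formula \<open>PP\<close> used in the axioms makes it explicit.\<close>

definition PP :: "nat \<Rightarrow> trm list \<Rightarrow> trm list \<Rightarrow> fm" where
  "PP h xs ys = AND (PP0 h xs ys)
     (Conjs {(i, j). 1 \<le> i \<and> i < j \<and> j \<le> h} (\<lambda>(i, j). NOT (EQ (nth1 ys i) (nth1 ys j))))"

definition QQ :: "(nat \<Rightarrow> nat set) \<Rightarrow> nat \<Rightarrow> trm list \<Rightarrow> trm list \<Rightarrow> trm list \<Rightarrow> fm" where
  "QQ f h xs ys zs =
     AND (Conjs {1..2^h-1} (\<lambda>i. LE (nth1 zs i) (nth1 xs 1)))
    (AND (Conjs {(i, j) \<in> {1..2^h-1} \<times> {1..2^h-1}. f i \<subseteq> f j} (\<lambda>(i, j). LE (nth1 zs i) (nth1 zs j)))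
    (AND (Conjs {(i, j) \<in> {1..2^h-1} \<times> {1..length ys}. j \<in> f i}
           (\<lambda>(i, j). LE (nth1 ys j) (nth1 zs i)))
         (Conjs {(i, j) \<in> {1..2^h-1} \<times> {1..length ys}. j \<notin> f i}
           (\<lambda>(i, j). NOT (LE (nth1 ys j) (nth1 zs i))))))"

definition FS :: "(nat \<Rightarrow> nat set) \<Rightarrow> nat \<Rightarrow> trm list \<Rightarrow> trm list \<Rightarrow> fm" where
  "FS f h xs ys = FF (PP h) (QQ f h) (2^h-1) xs ys"

definition DN :: "trm \<Rightarrow> trm \<Rightarrow> trm \<Rightarrow> fm" where
  "DN x y z = IMP (EQ (Neg (Neg x)) (Join y z)) (OR (EQ y (Neg (Neg x))) (EQ z (Neg (Neg x))))"

definition xvars :: "nat \<Rightarrow> trm list" where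
  "xvars n = map Var [1..<n+1]"

definition yvars :: "nat \<Rightarrow> nat \<Rightarrow> trm list" where
  "yvars n m = map Var [n+1..<n+m+1]"

text \<open>The bijection used for \<open>h\<close> is \<open>f h\<close>.\<close>

definition Sigma_axioms :: "(nat \<Rightarrow> nat \<Rightarrow> nat set) \<Rightarrow> fm set" where
  "Sigma_axioms f =
     {universal_closure (NOT (EQ Zero One)), universal_closure (DN (Var 1) (Var 2) (Var 3))} \<union>
     {universal_closure (FS (f h) h (xvars n) (yvars n m)) | n m h. 1 \<le> n \<and> 1 \<le> h \<and> h \<le> m}"

lemma finite_SS: "finite (SS n)"
  by (rule finite_subset[of _ "Pow {1..n} \<times> Pow (Pow {1..n})"]) (auto simp: SS_def)

lemma FF_PP0_fails:
  assumes "bij_betw f {1..2^2-1} (Pow {1..2} - {{}})" and nontriv: "(bot::'a::pdl) \<noteq> top"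
  shows "\<not> models TYPE('a) (universal_closure (FF (PP0 2) (QQ f 2) (2^2-1) (xvars 1) (yvars 1 2)))"
proof
  let ?xs = "xvars 1" and ?ys = "yvars 1 2"
  let ?v = "?xs @ ?ys"
  note [simp del] = One_nat_def
  define e :: "nat \<Rightarrow> 'a" where "e = (\<lambda>_. top)"
  assume "models TYPE('a) (universal_closure (FF (PP0 2) (QQ f 2) (2^2-1) ?xs ?ys))"
  then have F: "sat e (FF (PP0 2) (QQ f 2) (2^2-1) ?xs ?ys)"
    by (simp add: models_universal_closure)
  have xs: "?xs = [Var 1]" and ys: "?ys = [Var 2, Var 3]"
    by (simp_all add: xvars_def yvars_def upt_rec One_nat_def)
  have neg: "- top = (bot::'a)" "- bot = (top::'a)"
    using le_uminus_iff[of "- top :: 'a" top] le_uminus_iff[of "top :: 'a" bot]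
    by (simp_all add: top_unique)
  have nth: "tval e (nth1 ?v i) = top" if "i \<in> {1..3}" for i
  proof -
    from that have "i = 1 \<or> i = 2 \<or> i = 3" by auto
    then show ?thesis unfolding xs ys by (auto simp: nth1_def e_def One_nat_def)
  qed
  have len: "length ?v = 3"
    by (simp add: xvars_def yvars_def)
  have M: "tval e (Meets {1..3} (\<lambda>i. nth1 ?v i)) = top"
    by (rule top_le) (simp add: tval_Meets_le_iff nth)
  have a: "tval e (aT ?v {1..3}) = top"
    unfolding aT_def len using M by (simp add: top_unique[symmetric] tval_Meets_le_iff)
  have "top \<le> tval e (Joins {{1..3}} (aT ?v))"
    using tval_Joins_le_iff[of "{{1..3}}" e "aT ?v" "tval e (Joins {{1..3}} (aT ?v))"] a by simp
  then have p: "tval e (pLT ?v ({1..3}, {{1..3}})) = top"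
    using M by (simp add: pLT_def neg top_unique)
  have q: "tval e (pLT ?v (L, {})) = bot" for L
    using tval_Joins_le_iff[of "{}" e "aT ?v" bot] by (simp add: pLT_def neg bot_unique)
  have less: "q = ({1..3}, {})" if "q \<in> SS 3" "SS_less q ({1..3}, {{1..3}})" for q
    using that by (auto simp: SS_def SS_less_def SS_le_def)
  have "tval e (Joins {q \<in> SS 3. SS_less q ({1..3}, {{1..3}})} (pLT ?v)) \<le> bot"
    by (subst tval_Joins_le_iff) (auto simp: finite_SS dest!: less simp: q)
  then have nj: "tval e (Joins {q \<in> SS 3. SS_less q ({1..3}, {{1..3}})} (pLT ?v)) \<noteq> top"
    using nontriv by (simp add: bot_unique)
  have mem: "({1..3}, {{1..3}}) \<in> SS 3"
    by (auto simp: SS_def)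
  have J: "sat e (Jirr t ?v)" if "tval e t = top" for t
    unfolding Jirr_def len sat_Disjs[OF finite_SS]
    by (rule bexI[of _ "({1..3}, {{1..3}})"]) (use that p nj mem in simp_all)
  have At: "sat e (At t ?v)" if "tval e t = top" for t
  proof -
    have "sat e (Disjs (Pow {1..3}) (\<lambda>T. EQ t (aT ?v T)))"
      by (subst sat_Disjs, simp, rule bexI[of _ "{1..3}"]) (use that a in simp_all)
    then show ?thesis
      unfolding At_def len using that nontriv by simp
  qed
  have y: "tval e (nth1 ?ys i) = top" if "i \<in> {1..2}" for i
  proof -
    from that have "i = 1 \<or> i = 2" by auto
    then show ?thesis unfolding ys by (auto simp: nth1_def e_def One_nat_def)
  qed
  have x: "tval e (nth1 ?xs 1) = top"
    unfolding xs by (simp add: nth1_def e_def)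
  have ly: "length ?ys = 2" by (simp add: yvars_def)
  have "sat e (PP0 2 ?xs ?ys)"
    by (simp add: PP0_def sat_Conjs LE_def x y ly)
  moreover have fl: "finite {ps. length ps = k \<and> set ps \<subseteq> SS n}" for k n
    using finite_lists_length_eq[OF finite_SS] by (simp add: conj_commute)
  moreover have "sat e (Jirr (nth1 ?xs 1) ?v)"
    by (rule J[OF x])
  moreover have "sat e (Conjs {1..length ?ys} (\<lambda>i. At (nth1 ?ys i) ?v))"
    unfolding ly by (simp add: sat_Conjs At y del: atLeastAtMost_iff)
  ultimately obtain zs where Q: "sat e (QQ f 2 ?xs ?ys zs)"
    using F unfolding FF_def sat.simps unfolding sat_Disjs[OF fl] sat.simps by blast
  have "{1} \<in> f ` {1..2^2-1}"
    unfolding bij_betw_imp_surj_on[OF assms(1)] by auto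
  then obtain i where i: "i \<in> {1..2^2-1}" "f i = {1}"
    by force
  have fin: "finite {(i, j). (i, j) \<in> {1..2^2-1::nat} \<times> {1..2::nat} \<and> R i j}" for R
    by (rule finite_subset[of _ "{1..2^2-1} \<times> {1..2}"]) auto
  have i1: "(i, 1) \<in> {(i, j). (i, j) \<in> {1..2^2-1} \<times> {1..2::nat} \<and> j \<in> f i}"
    and i2: "(i, 2) \<in> {(i, j). (i, j) \<in> {1..2^2-1} \<times> {1..2::nat} \<and> j \<notin> f i}"
    using i by auto
  note Q' = Q[unfolded QQ_def ly sat.simps(3) sat_Conjs[OF fin], THEN conjunct2, THEN conjunct2]
  have "sat e (LE (nth1 ?ys 1) (nth1 zs i))" "sat e (NOT (LE (nth1 ?ys 2) (nth1 zs i)))"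
    using bspec[OF Q'[THEN conjunct1] i1] bspec[OF Q'[THEN conjunct2] i2]
    by (simp_all only: prod.case)
  then show False
    by (simp add: LE_def y)
qed

end

theory Submission
  imports Defs
begin

text \<open>The proof is a finite duality argument. Evaluate the variables \<open>1, \<dots>, N\<close> in a
  pseudocomplemented distributive lattice by \<open>e\<close>. A prime filter \<open>P\<close> then leaves a finite trace: the
  set \<open>L\<close> of those \<open>i\<close> with \<open>e i \<in> P\<close>, and the family \<open>\<T>\<close> of the sets obtained in the same way from the
  ultrafilters that contain \<open>P\<close>. Since \<open>- a \<in> P\<close> holds exactly if no ultrafilter above \<open>P\<close>
  contains \<open>a\<close>, the pair \<open>(L, \<T>)\<close>, called a point, already decides which terms have their value in \<open>P\<close>
  (\<open>tval_mem_prime_iff\<close>). By the prime filter theorem, the set of all points that occur, the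
  spectrum of \<open>e\<close>, therefore determines all equations between terms, and so the truth of every
  quantifier-free formula. In the free algebra, with the generators as values, every pair
  \<open>(L, \<T>)\<close> with \<open>\<T> \<noteq> {}\<close> and \<open>L \<subseteq> \<Inter>\<T>\<close> occurs (\<open>spectrum_gen\<close>). A change of variables acts on
  spectra by the map \<open>pull\<close>, which is monotone and acts on the second components elementwise. Thus the
  spectra of valuations in the free algebra are exactly the images of sets \<open>points M\<close> under such maps
  (\<open>spectrum_gen_terms\<close>, \<open>spectrum_of_monotone_map\<close>).

  In this language the axioms are statements on the order of the spectrum. The term \<open>p\<^sub>q\<close> is forced
  exactly at the points below \<open>q\<close>, hence \<open>Jirr\<close> picks out the principal down-sets of points of the
  spectrum and \<open>At\<close> its minimal points. The axioms FS say that below each point \<open>q\<close> there is a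
  monotone family of points, one for each nonempty set of minimal points below \<open>q\<close>, having precisely
  these minimal points below it (\<open>sat_FS\<close>, \<open>spectrum_fan_below\<close>). The axiom DN says that each nonempty set \<open>S\<close> of
  minimal points has a largest point over it (\<open>spectrum_greatest_over\<close>).

  The free algebra satisfies these conditions because the second component of a pair \<open>(L, \<T>)\<close> can be
  shrunk freely, and because \<open>({}, \<T>\<^sub>1 \<union> \<T>\<^sub>2)\<close> is an upper bound of any two points
  (\<open>fan_exists_pull\<close>, \<open>free_pdl_DN\<close>). For the converse, a spectrum \<open>X\<close> satisfying the conditions must be the image of
  some \<open>points M\<close> under an admissible map (\<open>points_surjection\<close>). For each \<open>q \<in> X\<close> one reserves a point of
  \<open>points M\<close>, with disjoint second components for different \<open>q\<close>. The reserved
  point is sent to \<open>q\<close>, the points below it into the family that FS provides below \<open>q\<close>, and all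
  others to the largest points provided by DN. Hence a valuation in a model of the
  axioms and some valuation in the free algebra satisfy the same quantifier-free formulas
  in any given finite set of variables, so a universal sentence that fails in the model fails in the free algebra.\<close>

section \<open>Prime filters of pseudocomplemented distributive lattices\<close>

lemma inf_uminus_bot [simp]: "inf a (- a) = (bot :: 'a::pdl)"
  by (metis inf.commute le_uminus_iff order_refl)

definition lattice_filter :: "'a::pdl set \<Rightarrow> bool" where
  "lattice_filter F \<longleftrightarrow> top \<in> F \<and> (\<forall>a b. inf a b \<in> F \<longleftrightarrow> a \<in> F \<and> b \<in> F)"

definition lattice_ideal :: "'a::pdl set \<Rightarrow> bool" where
  "lattice_ideal I \<longleftrightarrow> bot \<in> I \<and> (\<forall>a b. sup a b \<in> I \<longleftrightarrow> a \<in> I \<and> b \<in> I)"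

lemma lattice_filter_up: "lattice_filter F \<Longrightarrow> a \<in> F \<Longrightarrow> a \<le> b \<Longrightarrow> b \<in> F"
  by (metis inf.absorb_iff1 lattice_filter_def)

lemma lattice_ideal_down: "lattice_ideal I \<Longrightarrow> b \<in> I \<Longrightarrow> a \<le> b \<Longrightarrow> a \<in> I"
  by (metis sup.absorb_iff2 lattice_ideal_def)

lemma lattice_filter_principal: "lattice_filter {x. a \<le> x}"
  by (auto simp: lattice_filter_def)

lemma lattice_ideal_principal: "lattice_ideal {x. x \<le> a}"
  by (auto simp: lattice_ideal_def)

lemma lattice_filter_adjoin:
  assumes "lattice_filter F"
  shows "lattice_filter {x. \<exists>g\<in>F. inf g a \<le> x}"
  unfolding lattice_filter_def
proof (intro conjI allI iffI)
  show "top \<in> {x. \<exists>g\<in>F. inf g a \<le> x}"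
    using assms by (auto simp: lattice_filter_def)
next
  fix b c
  assume "b \<in> {x. \<exists>g\<in>F. inf g a \<le> x} \<and> c \<in> {x. \<exists>g\<in>F. inf g a \<le> x}"
  then obtain g g' where "g \<in> F" "inf g a \<le> b" "g' \<in> F" "inf g' a \<le> c"
    by blast
  moreover from this have "inf (inf g g') a \<le> inf b c"
    by (meson inf.bounded_iff inf_le1 inf_le2 order_trans)
  ultimately have "inf g g' \<in> F" "inf (inf g g') a \<le> inf b c"
    using assms by (auto simp: lattice_filter_def)
  then show "inf b c \<in> {x. \<exists>g\<in>F. inf g a \<le> x}" by blast
qed auto

text \<open>Zorn's lemma gives a maximal filter \<open>G\<close> disjoint from \<open>I\<close>. The last conclusion is what maximality means:
  adjoining any further element makes the filter meet \<open>I\<close>. It yields primeness for every ideal \<open>I\<close>, and for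
  the zero ideal it yields complements as well.\<close>
lemma maximal_filter_avoiding:
  assumes F: "lattice_filter F" and I: "lattice_ideal I" and disj: "F \<inter> I = {}"
  obtains G where "lattice_filter G" "F \<subseteq> G" "G \<inter> I = {}"
    "\<forall>a. a \<notin> G \<longrightarrow> (\<exists>g\<in>G. inf g a \<in> I)"
proof -
  define \<A> where "\<A> = {G. lattice_filter G \<and> F \<subseteq> G \<and> G \<inter> I = {}}"
  have "\<exists>M\<in>\<A>. \<forall>X\<in>\<A>. M \<subseteq> X \<longrightarrow> X = M"
  proof (rule subset_Zorn_nonempty)
    show "\<A> \<noteq> {}" using assms by (auto simp: \<A>_def)
    fix \<C> assume ne: "\<C> \<noteq> {}" and ch: "subset.chain \<A> \<C>"
    have mem: "lattice_filter G \<and> F \<subseteq> G \<and> G \<inter> I = {}" if "G \<in> \<C>" for G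
      using that ch by (auto simp: \<A>_def subset.chain_def)
    have tot: "G \<subseteq> H \<or> H \<subseteq> G" if "G \<in> \<C>" "H \<in> \<C>" for G H
      using that ch by (auto simp: subset_chain_def)
    have "lattice_filter (\<Union>\<C>)"
      unfolding lattice_filter_def
    proof (intro conjI allI iffI)
      show "top \<in> \<Union>\<C>" using ne mem by (fastforce simp: lattice_filter_def)
    next
      fix a b assume "a \<in> \<Union>\<C> \<and> b \<in> \<Union>\<C>"
      then obtain G where "G \<in> \<C>" "a \<in> G" "b \<in> G" using tot by blast
      then show "inf a b \<in> \<Union>\<C>" using mem by (auto simp: lattice_filter_def)
    qed (use mem in \<open>auto simp: lattice_filter_def\<close>)
    moreover have "F \<subseteq> \<Union>\<C>" "\<Union>\<C> \<inter> I = {}" using ne mem by blast+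
    ultimately show "\<Union>\<C> \<in> \<A>" by (simp add: \<A>_def)
  qed
  then obtain G where G: "lattice_filter G" "F \<subseteq> G" "G \<inter> I = {}"
    and max: "\<And>X. X \<in> \<A> \<Longrightarrow> G \<subseteq> X \<Longrightarrow> X = G"
    unfolding \<A>_def by auto
  \<comment> \<open>If not, the filter generated by \<open>G\<close> and \<open>a\<close> still avoids \<open>I\<close>.\<close>
  have "\<exists>g\<in>G. inf g a \<in> I" if "a \<notin> G" for a
  proof (rule ccontr)
    assume no: "\<not> ?thesis"
    let ?H = "{x. \<exists>g\<in>G. inf g a \<le> x}"
    have "?H \<inter> I = {}" using no lattice_ideal_down[OF I] by blast
    moreover have sub: "G \<subseteq> ?H" by (auto intro: le_infI1)
    ultimately have "?H = G"
      using G(2) lattice_filter_adjoin[OF G(1)] by (intro max) (auto simp: \<A>_def)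
    moreover have "a \<in> ?H" using G(1) by (auto simp: lattice_filter_def)
    ultimately show False using that by simp
  qed
  with G show thesis by (intro that) auto
qed

definition prime_filter :: "'a::pdl set \<Rightarrow> bool" where
  "prime_filter P \<longleftrightarrow> lattice_filter P \<and> bot \<notin> P \<and> (\<forall>a b. sup a b \<in> P \<longleftrightarrow> a \<in> P \<or> b \<in> P)"

definition ultrafilter :: "'a::pdl set \<Rightarrow> bool" where
  "ultrafilter Q \<longleftrightarrow> prime_filter Q \<and> (\<forall>a. - a \<in> Q \<longleftrightarrow> a \<notin> Q)"

text \<open>If \<open>a\<close> and \<open>b\<close> both lie outside \<open>G\<close>, maximality gives \<open>g, h \<in> G\<close> with \<open>inf g a\<close> and \<open>inf h b\<close> in \<open>I\<close>; by
  distributivity \<open>inf (inf g h) (sup a b)\<close> is then in \<open>I\<close> as well, so \<open>sup a b\<close> cannot be in \<open>G\<close>.\<close>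
lemma prime_if_maximal_avoiding:
  assumes G: "lattice_filter G" and I: "lattice_ideal I" and disj: "G \<inter> I = {}"
    and max: "\<forall>a. a \<notin> G \<longrightarrow> (\<exists>g\<in>G. inf g a \<in> I)"
  shows "prime_filter G"
  unfolding prime_filter_def
proof (intro conjI allI iffI)
  show "bot \<notin> G" using I disj by (auto simp: lattice_ideal_def)
next
  fix a b assume ab: "sup a b \<in> G"
  show "a \<in> G \<or> b \<in> G"
  proof (rule ccontr)
    assume "\<not> ?thesis"
    then obtain g h where gh: "g \<in> G" "h \<in> G" "inf g a \<in> I" "inf h b \<in> I"
      using max by blast
    have "inf (inf g h) (sup a b) \<le> sup (inf g a) (inf h b)"
      unfolding inf_sup_distrib1 by (intro sup_mono inf_mono) simp_all
    moreover have "sup (inf g a) (inf h b) \<in> I" using I gh by (auto simp: lattice_ideal_def)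
    ultimately have "inf (inf g h) (sup a b) \<in> I" by (rule lattice_ideal_down[OF I, rotated])
    moreover have "inf (inf g h) (sup a b) \<in> G" using G gh ab by (auto simp: lattice_filter_def)
    ultimately show False using disj by blast
  qed
qed (use G in \<open>auto intro: lattice_filter_up\<close>)

lemma prime_filter_separates:
  fixes a b :: "'a::pdl"
  assumes "\<not> a \<le> b"
  obtains P where "prime_filter P" "a \<in> P" "b \<notin> P"
proof -
  have disj: "{x. a \<le> x} \<inter> {x. x \<le> b} = {}" using assms by auto
  obtain G where "lattice_filter G" "{x. a \<le> x} \<subseteq> G" "G \<inter> {x. x \<le> b} = {}"
    "\<forall>c. c \<notin> G \<longrightarrow> (\<exists>g\<in>G. inf g c \<in> {x. x \<le> b})"
    by (rule maximal_filter_avoiding[OF lattice_filter_principal lattice_ideal_principal disj]) blast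
  moreover from this have "prime_filter G"
    using prime_if_maximal_avoiding[OF _ lattice_ideal_principal] by metis
  ultimately show thesis by (intro that[of G]) auto
qed

text \<open>If \<open>inf g a = bot\<close> for some \<open>g \<in> P\<close>, then \<open>g \<le> - a\<close> and \<open>- a \<in> P\<close>. So \<open>P\<close> and \<open>a\<close> generate a
  proper filter, and a maximal proper filter above it contains \<open>- c\<close> as soon as it misses \<open>c\<close>.\<close>
lemma ultrafilter_extends:
  assumes P: "prime_filter P" and a: "- a \<notin> P"
  obtains Q where "ultrafilter Q" "P \<subseteq> Q" "a \<in> Q"
proof -
  let ?F = "{x. \<exists>g\<in>P. inf g a \<le> x}"
  have PF: "lattice_filter P" using P by (simp add: prime_filter_def)
  have disj: "?F \<inter> {x. x \<le> bot} = {}"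
  proof (rule ccontr)
    assume "\<not> ?thesis"
    then obtain g where "g \<in> P" "inf g a = bot"
      by (auto simp: bot_unique)
    then have "g \<le> - a" by (simp add: le_uminus_iff)
    with \<open>g \<in> P\<close> a show False using lattice_filter_up[OF PF] by blast
  qed
  obtain G where G: "lattice_filter G" "?F \<subseteq> G" "G \<inter> {x. x \<le> bot} = {}"
    "\<forall>c. c \<notin> G \<longrightarrow> (\<exists>g\<in>G. inf g c \<in> {x. x \<le> bot})"
    by (rule maximal_filter_avoiding[OF lattice_filter_adjoin[OF PF] lattice_ideal_principal disj]) blast
  have prime: "prime_filter G"
    using prime_if_maximal_avoiding[OF G(1) lattice_ideal_principal G(3,4)] .
  have "- c \<in> G \<longleftrightarrow> c \<notin> G" for c
  proof
    assume "- c \<in> G"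
    show "c \<notin> G"
    proof
      assume "c \<in> G"
      with \<open>- c \<in> G\<close> have "inf c (- c) \<in> G"
        using G(1) unfolding lattice_filter_def by blast
      then have "bot \<in> G" by simp
      then show False using prime by (simp add: prime_filter_def)
    qed
  next
    assume "c \<notin> G"
    then obtain g where "g \<in> G" "g \<le> - c" using G(4) by (auto simp: le_uminus_iff bot_unique)
    then show "- c \<in> G" using lattice_filter_up[OF G(1)] by blast
  qed
  with prime have "ultrafilter G" by (simp add: ultrafilter_def)
  moreover have "P \<subseteq> ?F" "a \<in> ?F" using PF by (auto simp: lattice_filter_def intro: le_infI1)
  ultimately show thesis using G(2) by (intro that[of G]) blast+
qed

text \<open>By the extension property, pseudocomplements in \<open>P\<close> are read off the ultrafilters above \<open>P\<close> alone. This is why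
  a point has to record nothing else about the larger filters, and why its second component is a plain set of sets.\<close>
lemma uminus_mem_prime_iff:
  assumes P: "prime_filter P"
  shows "- a \<in> P \<longleftrightarrow> (\<forall>Q. ultrafilter Q \<longrightarrow> P \<subseteq> Q \<longrightarrow> a \<notin> Q)"
proof (intro iffI allI impI)
  fix Q assume "- a \<in> P" "ultrafilter Q" "P \<subseteq> Q"
  then show "a \<notin> Q" by (auto simp: ultrafilter_def)
next
  assume *: "\<forall>Q. ultrafilter Q \<longrightarrow> P \<subseteq> Q \<longrightarrow> a \<notin> Q"
  show "- a \<in> P"
  proof (rule ccontr)
    assume "- a \<notin> P"
    then obtain Q where "ultrafilter Q" "P \<subseteq> Q" "a \<in> Q"
      by (rule ultrafilter_extends[OF P])
    with * show False by blast
  qed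
qed

lemma ultrafilter_maximal:
  assumes "ultrafilter Q" "ultrafilter R" "Q \<subseteq> R"
  shows "R = Q"
  using assms unfolding ultrafilter_def by blast

section \<open>Points and forcing\<close>

type_synonym point = "nat set \<times> nat set set"

text \<open>Terms are evaluated as in a Kripke model in which negation at \<open>(L, \<T>)\<close> refers to the points
  \<open>(T, {T})\<close> with \<open>T \<in> \<T>\<close>, which stand for ultrafilters and where the evaluation is classical. In the
  order \<open>SS_le\<close> these are the minimal points below \<open>(L, \<T>)\<close>: larger filters are smaller points.\<close>
primrec forces :: "trm \<Rightarrow> point \<Rightarrow> bool" where
  "forces (Var i) q \<longleftrightarrow> i \<in> fst q"
| "forces Zero q \<longleftrightarrow> False"
| "forces One q \<longleftrightarrow> True"
| "forces (Meet s t) q \<longleftrightarrow> forces s q \<and> forces t q"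
| "forces (Join s t) q \<longleftrightarrow> forces s q \<or> forces t q"
| "forces (Neg t) q \<longleftrightarrow> (\<forall>T\<in>snd q. \<not> forces t (T, {T}))"

text \<open>The second component of a point is never empty, since every prime filter extends to an ultrafilter.
  The first component may be empty, in contrast to \<open>SS N\<close>.\<close>
definition points :: "nat \<Rightarrow> point set" where
  "points N = {q. snd q \<noteq> {} \<and> snd q \<subseteq> Pow {1..N} \<and> fst q \<subseteq> \<Inter>(snd q)}"

lemma SS_le_iff: "SS_le q r \<longleftrightarrow> fst r \<subseteq> fst q \<and> snd q \<subseteq> snd r"
  by (auto simp: SS_le_def split: prod.split)

lemma SS_le_refl [simp]: "SS_le q q"
  by (simp add: SS_le_iff)

lemma SS_le_trans: "SS_le q r \<Longrightarrow> SS_le r s \<Longrightarrow> SS_le q s"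
  by (auto simp: SS_le_iff)

lemma SS_le_antisym: "SS_le q r \<Longrightarrow> SS_le r q \<Longrightarrow> q = r"
  by (auto simp: SS_le_iff prod_eq_iff)

lemma forces_mono: "SS_le q r \<Longrightarrow> forces t r \<Longrightarrow> forces t q"
  by (induction t) (auto simp: SS_le_iff)

lemma fst_points: "q \<in> points N \<Longrightarrow> fst q \<subseteq> {1..N}"
  unfolding points_def by blast

lemma finite_points: "finite (points N)"
proof (rule finite_subset)
  show "points N \<subseteq> Pow {1..N} \<times> Pow (Pow {1..N})"
  proof
    fix q assume q: "q \<in> points N"
    then have "snd q \<subseteq> Pow {1..N}" by (simp add: points_def)
    with fst_points[OF q] show "q \<in> Pow {1..N} \<times> Pow (Pow {1..N})"
      by (cases q) auto
  qed
qed auto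

lemma atom_le: "q \<in> points N \<Longrightarrow> T \<in> snd q \<Longrightarrow> SS_le (T, {T}) q"
  by (auto simp: points_def SS_le_iff)

lemma le_atom: "q \<in> points N \<Longrightarrow> SS_le q (T, {T}) \<longleftrightarrow> q = (T, {T})"
  by (cases q) (force simp: points_def SS_le_iff)

lemma atom_in_points: "q \<in> points N \<Longrightarrow> T \<in> snd q \<Longrightarrow> (T, {T}) \<in> points N"
  by (auto simp: points_def)

lemma forces_Meets: "finite I \<Longrightarrow> forces (Meets I t) q \<longleftrightarrow> (\<forall>i\<in>I. forces (t i) q)"
proof -
  have "forces (foldr Meet (map t is) One) q \<longleftrightarrow> (\<forall>i\<in>set is. forces (t i) q)" for "is"
    by (induction "is") auto
  then show "finite I \<Longrightarrow> ?thesis" by (simp add: Meets_def)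
qed

lemma forces_Joins: "finite I \<Longrightarrow> forces (Joins I t) q \<longleftrightarrow> (\<exists>i\<in>I. forces (t i) q)"
proof -
  have "forces (foldr Join (map t is) Zero) q \<longleftrightarrow> (\<exists>i\<in>set is. forces (t i) q)" for "is"
    by (induction "is") auto
  then show "finite I \<Longrightarrow> ?thesis" by (simp add: Joins_def)
qed

lemma tvars_Meets: "finite I \<Longrightarrow> tvars (Meets I t) = (\<Union>i\<in>I. tvars (t i))"
proof -
  have "tvars (foldr Meet (map t is) One) = (\<Union>i\<in>set is. tvars (t i))" for "is"
    by (induction "is") auto
  then show "finite I \<Longrightarrow> ?thesis" by (simp add: Meets_def)
qed

lemma tvars_Joins: "finite I \<Longrightarrow> tvars (Joins I t) = (\<Union>i\<in>I. tvars (t i))"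
proof -
  have "tvars (foldr Join (map t is) Zero) = (\<Union>i\<in>set is. tvars (t i))" for "is"
    by (induction "is") auto
  then show "finite I \<Longrightarrow> ?thesis" by (simp add: Joins_def)
qed

lemma length_xvars [simp]: "length (xvars N) = N"
  by (simp add: xvars_def)

lemma nth1_xvars: "i \<in> {1..N} \<Longrightarrow> nth1 (xvars N) i = Var i"
  by (auto simp: nth1_def xvars_def simp del: upt_Suc)

lemma tvars_aT: "T \<subseteq> {1..N} \<Longrightarrow> tvars (aT (xvars N) T) \<subseteq> {1..N}"
  using nth1_xvars[of _ N] finite_subset[of T "{1..N}"] by (auto simp: aT_def tvars_Meets subset_iff)

lemma tvars_pLT:
  assumes "fst q \<subseteq> {1..N}" "snd q \<subseteq> Pow {1..N}"
  shows "tvars (pLT (xvars N) q) \<subseteq> {1..N}"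
proof -
  have "finite (snd q)" using assms(2) by (rule finite_subset) simp
  moreover have "finite (fst q)" using assms(1) by (rule finite_subset) simp
  moreover have "tvars (nth1 (xvars N) i) \<subseteq> {1..N}" if "i \<in> fst q" for i
    using that assms nth1_xvars[of i N] by auto
  moreover have "tvars (aT (xvars N) T) \<subseteq> {1..N}" if "T \<in> snd q" for T
    using that assms by (intro tvars_aT) auto
  ultimately show ?thesis
    by (auto simp: pLT_def tvars_Meets tvars_Joins case_prod_unfold subset_iff)
qed

text \<open>The meet \<open>a\<^sub>T\<close> fixes every variable positively or negatively, so it holds at the minimal point
  \<open>(T, {T})\<close> and nowhere else.\<close>
lemma forces_aT:
  assumes q: "q \<in> points N" and T: "T \<subseteq> {1..N}"
  shows "forces (aT (xvars N) T) q \<longleftrightarrow> q = (T, {T})"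
proof -
  have fT: "finite T" using T by (rule finite_subset) simp
  have "forces (aT (xvars N) T) q \<longleftrightarrow>
      (\<forall>i\<in>T. forces (nth1 (xvars N) i) q) \<and> (\<forall>i\<in>{1..N} - T. forces (Neg (nth1 (xvars N) i)) q)"
    using fT by (simp add: aT_def forces_Meets del: forces.simps(6))
  also have "\<dots> \<longleftrightarrow> T \<subseteq> fst q \<and> (\<forall>i\<in>{1..N} - T. \<forall>S\<in>snd q. i \<notin> S)"
    using T nth1_xvars[of _ N] by (auto simp: subset_iff)
  also have "\<dots> \<longleftrightarrow> q = (T, {T})"
  proof
    assume *: "T \<subseteq> fst q \<and> (\<forall>i\<in>{1..N} - T. \<forall>S\<in>snd q. i \<notin> S)"
    have "S = T" if "S \<in> snd q" for S
      using that * q by (fastforce simp: points_def)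
    then have "snd q = {T}" using q by (auto simp: points_def)
    then show "q = (T, {T})" using * q by (auto simp: points_def prod_eq_iff)
  qed auto
  finally show ?thesis .
qed

text \<open>The terms \<open>p\<^sub>r\<close> define exactly the principal down-sets. The two negations turn the join of the
  \<open>a\<^sub>T\<close> into a condition on all ultrafilters above the point.\<close>
lemma forces_pLT:
  assumes q: "q \<in> points N" and r: "fst r \<subseteq> {1..N}" "snd r \<subseteq> Pow {1..N}"
  shows "forces (pLT (xvars N) r) q \<longleftrightarrow> SS_le q r"
proof -
  have fr: "finite (snd r)" using r(2) by (rule finite_subset) simp
  have fr1: "finite (fst r)" using r(1) by (rule finite_subset) simp
  have a: "forces (aT (xvars N) T) (S, {S}) \<longleftrightarrow> S = T" if "S \<in> snd q" "T \<in> snd r" for S T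
    using forces_aT[OF atom_in_points[OF q], of S T] that r by auto
  have "forces (pLT (xvars N) r) q \<longleftrightarrow> (\<forall>i\<in>fst r. forces (nth1 (xvars N) i) q) \<and>
      (\<forall>S\<in>snd q. \<exists>T\<in>snd r. forces (aT (xvars N) T) (S, {S}))"
    using fr fr1 by (simp add: pLT_def case_prod_unfold forces_Meets forces_Joins)
  also have "(\<forall>S\<in>snd q. \<exists>T\<in>snd r. forces (aT (xvars N) T) (S, {S})) \<longleftrightarrow> snd q \<subseteq> snd r"
    using a by blast
  also have "(\<forall>i\<in>fst r. forces (nth1 (xvars N) i) q) \<longleftrightarrow> fst r \<subseteq> fst q"
    using r nth1_xvars[of _ N] by (auto simp: subset_iff)
  finally show ?thesis by (simp add: SS_le_iff)
qed

lemma forces_pLT_points: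
  assumes "q \<in> points N" "r \<in> points N"
  shows "forces (pLT (xvars N) r) q \<longleftrightarrow> SS_le q r"
  using assms fst_points[OF assms(2)] by (intro forces_pLT) (auto simp: points_def)

lemma tvars_pLT_points: "q \<in> points N \<Longrightarrow> tvars (pLT (xvars N) q) \<subseteq> {1..N}"
  by (intro tvars_pLT fst_points) (simp_all add: points_def)

section \<open>The spectrum of a valuation\<close>

definition trace :: "nat \<Rightarrow> (nat \<Rightarrow> 'a::pdl) \<Rightarrow> 'a set \<Rightarrow> nat set" where
  "trace N e P = {i\<in>{1..N}. e i \<in> P}"

definition type_of :: "nat \<Rightarrow> (nat \<Rightarrow> 'a::pdl) \<Rightarrow> 'a set \<Rightarrow> point" where
  "type_of N e P = (trace N e P, trace N e ` {Q. ultrafilter Q \<and> P \<subseteq> Q})"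

definition spectrum :: "nat \<Rightarrow> (nat \<Rightarrow> 'a::pdl) \<Rightarrow> point set" where
  "spectrum N e = type_of N e ` {P. prime_filter P}"

lemma type_of_ultrafilter:
  assumes "ultrafilter Q"
  shows "type_of N e Q = (trace N e Q, {trace N e Q})"
proof -
  have "{R. ultrafilter R \<and> Q \<subseteq> R} = {Q}"
    using assms ultrafilter_maximal by blast
  then show ?thesis by (simp add: type_of_def)
qed

text \<open>The induction runs over all prime filters at once, because the case of \<open>Neg\<close> passes from \<open>P\<close> to the
  ultrafilters above it.\<close>
lemma tval_mem_prime_iff:
  assumes "prime_filter P" "tvars t \<subseteq> {1..N}"
  shows "tval e t \<in> P \<longleftrightarrow> forces t (type_of N e P)"
  using assms
proof (induction t arbitrary: P)
  case (Neg t)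
  have "tval e t \<in> Q \<longleftrightarrow> forces t (trace N e Q, {trace N e Q})" if "ultrafilter Q" for Q
    using that Neg type_of_ultrafilter[OF that, of N e] by (auto simp: ultrafilter_def)
  then show ?case
    using uminus_mem_prime_iff[OF Neg.prems(1)] by (auto simp: type_of_def)
qed (auto simp: type_of_def trace_def prime_filter_def lattice_filter_def)

lemma type_of_in_points:
  assumes "prime_filter P"
  shows "type_of N e P \<in> points N"
proof -
  have "- top = (bot::'a)" using le_uminus_iff[of "- top::'a" top] by simp
  then have "- top \<notin> P" using assms by (simp add: prime_filter_def)
  then obtain Q where "ultrafilter Q" "P \<subseteq> Q" using ultrafilter_extends[OF assms] by metis
  then show ?thesis by (auto simp: points_def type_of_def trace_def)
qed

lemma spectrum_subset_points: "spectrum N e \<subseteq> points N"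
  using type_of_in_points by (auto simp: spectrum_def)

lemma atom_in_spectrum:
  assumes "q \<in> spectrum N e" "T \<in> snd q"
  shows "(T, {T}) \<in> spectrum N e"
proof -
  from assms obtain Q where "ultrafilter Q" "T = trace N e Q"
    by (auto simp: spectrum_def type_of_def)
  then have "type_of N e Q = (T, {T})" "prime_filter Q"
    using type_of_ultrafilter[of Q N e] by (auto simp: ultrafilter_def)
  then show ?thesis unfolding spectrum_def by (metis image_eqI mem_Collect_eq)
qed

text \<open>An inequality that fails is witnessed by a prime filter, hence by a point of the spectrum.\<close>
lemma tval_le_iff_spectrum:
  assumes "tvars s \<subseteq> {1..N}" "tvars t \<subseteq> {1..N}"
  shows "tval e s \<le> tval e t \<longleftrightarrow> (\<forall>q\<in>spectrum N e. forces s q \<longrightarrow> forces t q)"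
proof
  assume le: "tval e s \<le> tval e t"
  have "tval e s \<in> P \<longrightarrow> tval e t \<in> P" if "prime_filter P" for P
    using that le lattice_filter_up by (auto simp: prime_filter_def)
  then show "\<forall>q\<in>spectrum N e. forces s q \<longrightarrow> forces t q"
    using assms by (auto simp: spectrum_def tval_mem_prime_iff)
next
  assume *: "\<forall>q\<in>spectrum N e. forces s q \<longrightarrow> forces t q"
  show "tval e s \<le> tval e t"
  proof (rule ccontr)
    assume "\<not> tval e s \<le> tval e t"
    then obtain P where "prime_filter P" "tval e s \<in> P" "tval e t \<notin> P"
      by (rule prime_filter_separates)
    with * assms show False by (auto simp: spectrum_def tval_mem_prime_iff)
  qed
qed

lemma tval_eq_iff_spectrum:
  assumes "tvars s \<subseteq> {1..N}" "tvars t \<subseteq> {1..N}"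
  shows "tval e s = tval e t \<longleftrightarrow> (\<forall>q\<in>spectrum N e. forces s q \<longleftrightarrow> forces t q)"
  using tval_le_iff_spectrum[OF assms] tval_le_iff_spectrum[OF assms(2,1)]
  by (metis order_antisym order_refl)

text \<open>The effect of substituting the terms \<open>\<sigma> 1, \<dots>, \<sigma> N\<close> for the variables, dual to the homomorphism that
  the substitution induces.\<close>
definition pull :: "nat \<Rightarrow> (nat \<Rightarrow> trm) \<Rightarrow> point \<Rightarrow> point" where
  "pull N \<sigma> q = ({i\<in>{1..N}. forces (\<sigma> i) q}, (\<lambda>T. {i\<in>{1..N}. forces (\<sigma> i) (T, {T})}) ` snd q)"

lemma pull_mono: "SS_le q r \<Longrightarrow> SS_le (pull N \<sigma> q) (pull N \<sigma> r)"
  using forces_mono[of q r] by (auto simp: pull_def SS_le_iff)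

lemma spectrum_substitution:
  assumes e': "\<And>i. i \<in> {1..N'} \<Longrightarrow> e' i = tval e (\<sigma> i)"
    and \<sigma>: "\<And>i. i \<in> {1..N'} \<Longrightarrow> tvars (\<sigma> i) \<subseteq> {1..N}"
  shows "spectrum N' e' = pull N' \<sigma> ` spectrum N e"
proof -
  have tr: "trace N' e' P = {i\<in>{1..N'}. forces (\<sigma> i) (type_of N e P)}" if "prime_filter P" for P
    using e' \<sigma> tval_mem_prime_iff[OF that, of _ N e] by (auto simp: trace_def)
  have "type_of N' e' P = pull N' \<sigma> (type_of N e P)" if P: "prime_filter P" for P
  proof -
    have "trace N' e' Q = {i\<in>{1..N'}. forces (\<sigma> i) (trace N e Q, {trace N e Q})}"
      if "ultrafilter Q" for Q
      using tr[of Q] that type_of_ultrafilter[OF that, of N e] by (simp add: ultrafilter_def)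
    then show ?thesis
      using tr[OF P] by (auto simp: pull_def type_of_def[of N'] type_of_def[of N] image_image)
  qed
  then show ?thesis by (auto simp: spectrum_def image_image)
qed

section \<open>The spectrum of the generators of the free algebra\<close>

text \<open>Soundness of forcing for the equational theory. The rules for the pseudocomplement hold since each
  \<open>(T, {T})\<close> with \<open>T \<in> snd q\<close> lies below \<open>q\<close>, so that whatever is forced at \<open>q\<close> persists there.\<close>
lemma forces_pdl_eq:
  assumes "pdl_eq s t" "snd q \<noteq> {}" "fst q \<subseteq> \<Inter>(snd q)"
  shows "forces s q \<longleftrightarrow> forces t q"
  using assms
proof (induction arbitrary: q)
  case (pc1 s t)
  show ?case
  proof (rule iffI)
    assume st: "forces (Meet s t) q"
    from pc1.prems obtain T where T: "T \<in> snd q" by blast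
    then have "SS_le (T, {T}) q" using pc1.prems by (auto simp: SS_le_iff)
    then have "forces t (T, {T})" using st forces_mono by auto
    moreover have "forces (Meet s (Neg t)) q"
      using pc1.IH[OF pc1.prems] st by simp
    ultimately have False using T by (simp del: split_paired_All)
    then show "forces Zero q" ..
  qed simp
next
  case (pc2 s t)
  have "\<not> forces t (T, {T})" if "T \<in> snd q" "forces s q" for T
  proof -
    have "SS_le (T, {T}) q" using that pc2.prems by (auto simp: SS_le_iff)
    then have "forces s (T, {T})" using that forces_mono by auto
    then show ?thesis using pc2.IH[of "(T, {T})"] by auto
  qed
  then show ?case by auto
next
  case (cong_Neg s s')
  then show ?case by auto
next
  case (sym s t)
  then show ?case by metis
next
  case (trans s t u)
  then show ?case by metis
qed auto

lemma tval_gen: "tval gen t = abs_free_pdl t"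
  by (induction t) (auto simp: gen.abs_eq inf_free_pdl.abs_eq sup_free_pdl.abs_eq
      uminus_free_pdl.abs_eq bot_free_pdl.abs_eq top_free_pdl.abs_eq)

lemma free_pdl_term:
  obtains t where "a = tval gen t"
  using Quotient3_abs_rep[OF Quotient3_free_pdl] tval_gen by metis

text \<open>By soundness, the classes of the terms forced at a point \<open>r\<close> form a prime filter of the free algebra, and an
  ultrafilter if \<open>r = (T, {T})\<close>. The type of the filter at \<open>q\<close> is \<open>q\<close> again: each \<open>T \<in> snd q\<close> comes
  from the ultrafilter at \<open>(T, {T})\<close>, and no other set occurs because \<open>p\<^sub>q\<close> belongs to the filter.\<close>
lemma spectrum_gen: "spectrum N gen = points N"
proof
  show "points N \<subseteq> spectrum N gen"
  proof
    fix q assume q: "q \<in> points N"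
    define theory_at where "theory_at r = {tval gen t |t. forces t r}" for r :: point
    have mem: "tval gen t \<in> theory_at r \<longleftrightarrow> forces t r"
      if "snd r \<noteq> {}" "fst r \<subseteq> \<Inter>(snd r)" for t r
    proof
      assume "tval gen t \<in> theory_at r"
      then obtain s where "tval gen t = tval gen s" "forces s r" by (auto simp: theory_at_def)
      then have "pdl_eq t s" by (simp add: tval_gen free_pdl.abs_eq_iff)
      then show "forces t r" using forces_pdl_eq that \<open>forces s r\<close> by blast
    qed (auto simp: theory_at_def)
    have prime: "prime_filter (theory_at r)" if r: "snd r \<noteq> {}" "fst r \<subseteq> \<Inter>(snd r)" for r
      unfolding prime_filter_def lattice_filter_def
    proof (intro conjI allI)
      show "top \<in> theory_at r" using mem[OF r, of One] by simp
      show "bot \<notin> theory_at r" using mem[OF r, of Zero] by simp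
      fix a b
      obtain s t where "a = tval gen s" "b = tval gen t" using free_pdl_term by metis
      then show "inf a b \<in> theory_at r \<longleftrightarrow> a \<in> theory_at r \<and> b \<in> theory_at r"
        and "sup a b \<in> theory_at r \<longleftrightarrow> a \<in> theory_at r \<or> b \<in> theory_at r"
        using mem[OF r, of "Meet s t"] mem[OF r, of "Join s t"] mem[OF r] by simp_all
    qed
    have ultra: "ultrafilter (theory_at (T, {T}))" for T
      unfolding ultrafilter_def
    proof (intro conjI allI)
      show "prime_filter (theory_at (T, {T}))" by (rule prime) auto
      fix a
      obtain t where "a = tval gen t" using free_pdl_term by metis
      then show "- a \<in> theory_at (T, {T}) \<longleftrightarrow> a \<notin> theory_at (T, {T})"
        using mem[of "(T, {T})" t] mem[of "(T, {T})" "Neg t"] by simp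
    qed
    have q': "snd q \<noteq> {}" "fst q \<subseteq> \<Inter>(snd q)" using q by (auto simp: points_def)
    have tr: "trace N gen (theory_at r) = fst r"
      if "snd r \<noteq> {}" "fst r \<subseteq> \<Inter>(snd r)" "fst r \<subseteq> {1..N}" for r
      using mem[OF that(1,2), of "Var _"] that(3) by (auto simp: trace_def)
    let ?P = "theory_at q"
    have "type_of N gen ?P = q"
    proof (rule SS_le_antisym)
      have "tval gen (pLT (xvars N) q) \<in> ?P" using mem[OF q'] forces_pLT_points[OF q q] by simp
      then have "forces (pLT (xvars N) q) (type_of N gen ?P)"
        using tval_mem_prime_iff[OF prime[OF q'] tvars_pLT_points[OF q]] by blast
      then show "SS_le (type_of N gen ?P) q"
        using forces_pLT_points[OF type_of_in_points[OF prime[OF q']] q] by blast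
      have "T \<in> snd (type_of N gen ?P)" if T: "T \<in> snd q" for T
      proof -
        have "?P \<subseteq> theory_at (T, {T})"
          using forces_mono[OF atom_le[OF q T]] by (auto simp: theory_at_def)
        moreover have "trace N gen (theory_at (T, {T})) = T"
          using tr[of "(T, {T})"] T q by (auto simp: points_def)
        ultimately show ?thesis using ultra[of T] unfolding type_of_def by force
      qed
      then show "SS_le q (type_of N gen ?P)"
        using tr[OF q' fst_points[OF q]] by (auto simp: SS_le_iff type_of_def)
    qed
    then show "q \<in> spectrum N gen" using prime[OF q'] unfolding spectrum_def by force
  qed
qed (rule spectrum_subset_points)

section \<open>The axioms in terms of spectra\<close>

lemma sat_LE: "sat e (LE s t) \<longleftrightarrow> tval e s \<le> tval e t"
  by (simp add: LE_def inf.absorb_iff1)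

lemma points_in_SS: "q \<in> points N \<Longrightarrow> fst q \<noteq> {} \<Longrightarrow> q \<in> SS N"
  using fst_points[of q N] by (cases q) (auto simp: points_def SS_def)

lemma atom_le_iff: "q \<in> points N \<Longrightarrow> SS_le (T, {T}) q \<longleftrightarrow> T \<in> snd q"
  by (auto simp: points_def SS_le_iff)

text \<open>A term that satisfies \<open>At\<close> is one that is forced at precisely one minimal point of the spectrum.\<close>
lemma sat_At:
  assumes t: "tvars t \<subseteq> {1..N}"
  shows "sat e (At t (xvars N)) \<longleftrightarrow>
    (\<exists>T. (T, {T}) \<in> spectrum N e \<and> (\<forall>w\<in>spectrum N e. forces t w \<longleftrightarrow> w = (T, {T})))"
proof -
  have "sat e (At t (xvars N)) \<longleftrightarrow>
      tval e t \<noteq> tval e Zero \<and> (\<exists>T\<in>Pow {1..N}. tval e t = tval e (aT (xvars N) T))"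
    by (simp add: At_def sat_Disjs)
  also have "\<dots> \<longleftrightarrow> (\<exists>w\<in>spectrum N e. forces t w) \<and>
      (\<exists>T\<in>Pow {1..N}. \<forall>w\<in>spectrum N e. forces t w \<longleftrightarrow> w = (T, {T}))"
  proof -
    have "tval e t = tval e (aT (xvars N) T) \<longleftrightarrow> (\<forall>w\<in>spectrum N e. forces t w \<longleftrightarrow> w = (T, {T}))"
      if "T \<in> Pow {1..N}" for T
      using tval_eq_iff_spectrum[OF t tvars_aT, of T e] that
        forces_aT[of _ N T] spectrum_subset_points[of N e] by auto
    then show ?thesis using tval_eq_iff_spectrum[OF t, of Zero e] by auto
  qed
  also have "\<dots> \<longleftrightarrow>
      (\<exists>T. (T, {T}) \<in> spectrum N e \<and> (\<forall>w\<in>spectrum N e. forces t w \<longleftrightarrow> w = (T, {T})))"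
  proof -
    have "T \<in> Pow {1..N}" if "(T, {T}) \<in> spectrum N e" for T
    proof -
      have "(T, {T}) \<in> points N" using that spectrum_subset_points by (rule subsetD[rotated])
      then show ?thesis using fst_points[of "(T, {T})" N] by simp
    qed
    then show ?thesis by metis
  qed
  finally show ?thesis .
qed

text \<open>The join of the \<open>p\<^sub>r\<close> with \<open>r < q\<close> is forced at all points below \<open>q\<close> except \<open>q\<close> itself. So \<open>p\<^sub>q\<close>
  differs from that join exactly if \<open>q\<close> occurs in the spectrum. Points below \<open>q\<close> have a nonempty first component
  when \<open>q\<close> has one, and this is why \<open>SS N\<close> contains all the points that are needed.\<close>
lemma sat_Jirr:
  assumes t: "tvars t \<subseteq> {1..N}"
  shows "sat e (Jirr t (xvars N)) \<longleftrightarrow>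
    (\<exists>q\<in>spectrum N e. fst q \<noteq> {} \<and> (\<forall>w\<in>spectrum N e. forces t w \<longleftrightarrow> SS_le w q))"
proof -
  let ?X = "spectrum N e"
  have SSD: "fst q \<subseteq> {1..N}" "snd q \<subseteq> Pow {1..N}" "fst q \<noteq> {}" if "q \<in> SS N" for q
    using that by (auto simp: SS_def)
  have p: "forces (pLT (xvars N) q) w \<longleftrightarrow> SS_le w q" if "q \<in> SS N" "w \<in> ?X" for q w
    using forces_pLT[of w N q] SSD[of q] that spectrum_subset_points[of N e] by auto
  let ?J = "\<lambda>q. Joins {r \<in> SS N. SS_less r q} (pLT (xvars N))"
  have fin: "finite {r \<in> SS N. SS_less r q}" for q
    using finite_SS[of N] by simp
  have J: "forces (?J q) w \<longleftrightarrow> SS_le w q \<and> w \<noteq> q" if q: "q \<in> SS N" and w: "w \<in> ?X" for q w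
  proof -
    have "forces (?J q) w \<longleftrightarrow> (\<exists>r\<in>SS N. SS_less r q \<and> SS_le w r)"
      using fin p w by (auto simp: forces_Joins)
    also have "\<dots> \<longleftrightarrow> SS_le w q \<and> w \<noteq> q"
    proof
      assume "\<exists>r\<in>SS N. SS_less r q \<and> SS_le w r"
      then show "SS_le w q \<and> w \<noteq> q"
        unfolding SS_less_def using SS_le_trans SS_le_antisym by blast
    next
      assume *: "SS_le w q \<and> w \<noteq> q"
      then have "fst w \<noteq> {}" using SSD[OF q] by (auto simp: SS_le_iff)
      then have "w \<in> SS N" using w spectrum_subset_points[of N e] points_in_SS by blast
      then show "\<exists>r\<in>SS N. SS_less r q \<and> SS_le w r"
        using * by (auto simp: SS_less_def)
    qed
    finally show ?thesis .
  qed
  have "sat e (Jirr t (xvars N)) \<longleftrightarrow>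
      (\<exists>q\<in>SS N. tval e t = tval e (pLT (xvars N) q) \<and> tval e t \<noteq> tval e (?J q))"
    by (simp add: Jirr_def sat_Disjs[OF finite_SS])
  also have "\<dots> \<longleftrightarrow> (\<exists>q\<in>SS N. (\<forall>w\<in>?X. forces t w \<longleftrightarrow> SS_le w q) \<and>
      \<not> (\<forall>w\<in>?X. forces t w \<longleftrightarrow> SS_le w q \<and> w \<noteq> q))"
  proof (rule bex_cong[OF HOL.refl])
    fix q assume q: "q \<in> SS N"
    have tJ: "tvars (?J q) \<subseteq> {1..N}"
      using tvars_pLT[OF SSD(1,2)] unfolding tvars_Joins[OF fin] by blast
    have "tval e t = tval e (?J q) \<longleftrightarrow> (\<forall>w\<in>?X. forces t w \<longleftrightarrow> SS_le w q \<and> w \<noteq> q)"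
      using tval_eq_iff_spectrum[OF t tJ, of e] J[OF q] by simp
    moreover have "tval e t = tval e (pLT (xvars N) q) \<longleftrightarrow> (\<forall>w\<in>?X. forces t w \<longleftrightarrow> SS_le w q)"
      using tval_eq_iff_spectrum[OF t tvars_pLT[OF SSD(1)[OF q] SSD(2)[OF q]], of e] p[OF q] by simp
    ultimately show "(tval e t = tval e (pLT (xvars N) q) \<and> tval e t \<noteq> tval e (?J q)) \<longleftrightarrow>
        (\<forall>w\<in>?X. forces t w \<longleftrightarrow> SS_le w q) \<and>
        \<not> (\<forall>w\<in>?X. forces t w \<longleftrightarrow> SS_le w q \<and> w \<noteq> q)" by simp
  qed
  also have "\<dots> \<longleftrightarrow> (\<exists>q\<in>?X. fst q \<noteq> {} \<and> (\<forall>w\<in>?X. forces t w \<longleftrightarrow> SS_le w q))"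
    (is "?A \<longleftrightarrow> _")
  proof -
    have iff: "\<not> (\<forall>w\<in>?X. forces t w \<longleftrightarrow> SS_le w q \<and> w \<noteq> q) \<longleftrightarrow> q \<in> ?X"
      if "\<forall>w\<in>?X. forces t w \<longleftrightarrow> SS_le w q" for q
      using that SS_le_refl[of q] by (auto simp del: SS_le_refl)
    have "q \<in> SS N \<longleftrightarrow> fst q \<noteq> {}" if "q \<in> ?X" for q
      using that SSD(3) points_in_SS spectrum_subset_points[of N e] by blast
    then have mem: "q \<in> SS N \<and> q \<in> ?X \<longleftrightarrow> q \<in> ?X \<and> fst q \<noteq> {}" for q
      by blast
    have "?A \<longleftrightarrow> (\<exists>q. (q \<in> SS N \<and> q \<in> ?X) \<and> (\<forall>w\<in>?X. forces t w \<longleftrightarrow> SS_le w q))"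
      unfolding Bex_def using iff by (intro ex_cong1) blast
    then show ?thesis unfolding mem by (simp only: Bex_def conj_assoc)
  qed
  finally show ?thesis .
qed

lemma sat_PP:
  assumes "h \<le> length ys"
  shows "sat e (PP h xs ys) \<longleftrightarrow>
    (\<forall>j\<in>{1..length ys}. tval e (nth1 ys j) \<le> tval e (nth1 xs 1) \<longleftrightarrow> j \<le> h) \<and>
    inj_on (\<lambda>j. tval e (nth1 ys j)) {1..h}"
proof -
  have fin: "finite {(i, j). 1 \<le> i \<and> i < j \<and> j \<le> h}"
    by (rule finite_subset[of _ "{1..h} \<times> {1..h}"]) auto
  have pairs: "(\<forall>x\<in>{(i, j). R i j}. sat e (case x of (i, j) \<Rightarrow> \<phi> i j)) \<longleftrightarrow>
      (\<forall>i j. R i j \<longrightarrow> sat e (\<phi> i j))" for R :: "nat \<Rightarrow> nat \<Rightarrow> bool" and \<phi>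
    by auto
  have "sat e (PP h xs ys) \<longleftrightarrow>
      (\<forall>j\<in>{1..h}. tval e (nth1 ys j) \<le> tval e (nth1 xs 1)) \<and>
      (\<forall>j\<in>{h+1..length ys}. \<not> tval e (nth1 ys j) \<le> tval e (nth1 xs 1)) \<and>
      (\<forall>i j. 1 \<le> i \<and> i < j \<and> j \<le> h \<longrightarrow> tval e (nth1 ys i) \<noteq> tval e (nth1 ys j))"
    by (simp only: PP_def PP0_def sat.simps sat_Conjs[OF fin] sat_Conjs[OF finite_atLeastAtMost]
        pairs sat_LE tval.simps conj_assoc)
  moreover have "(\<forall>i j. 1 \<le> i \<and> i < j \<and> j \<le> h \<longrightarrow> tval e (nth1 ys i) \<noteq> tval e (nth1 ys j)) \<longleftrightarrow>
      inj_on (\<lambda>j. tval e (nth1 ys j)) {1..h}"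
  proof (rule iffI)
    let ?v = "\<lambda>j. tval e (nth1 ys j)"
    show "inj_on ?v {1..h}" if *: "\<forall>i j. 1 \<le> i \<and> i < j \<and> j \<le> h \<longrightarrow> ?v i \<noteq> ?v j"
    proof (rule linorder_inj_onI)
      fix i j assume "i < j" "i \<in> {1..h}" "j \<in> {1..h}"
      then show "?v i \<noteq> ?v j" using *[rule_format, of i j] by simp
    qed auto
    show "\<forall>i j. 1 \<le> i \<and> i < j \<and> j \<le> h \<longrightarrow> ?v i \<noteq> ?v j" if "inj_on ?v {1..h}"
      using that by (auto dest: inj_onD)
  qed
  moreover have "{1..length ys} = {1..h} \<union> {h+1..length ys}" using assms by auto
  then have "(\<forall>j\<in>{1..length ys}. tval e (nth1 ys j) \<le> tval e (nth1 xs 1) \<longleftrightarrow> j \<le> h) \<longleftrightarrow>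
      (\<forall>j\<in>{1..h}. tval e (nth1 ys j) \<le> tval e (nth1 xs 1)) \<and>
      (\<forall>j\<in>{h+1..length ys}. \<not> tval e (nth1 ys j) \<le> tval e (nth1 xs 1))"
    by (auto simp: ball_Un)
  ultimately show ?thesis by blast
qed

lemma sat_QQ:
  "sat e (QQ f h xs ys zs) \<longleftrightarrow>
    (\<forall>i\<in>{1..2^h-1}. tval e (nth1 zs i) \<le> tval e (nth1 xs 1)) \<and>
    (\<forall>i\<in>{1..2^h-1}. \<forall>j\<in>{1..2^h-1}. f i \<subseteq> f j \<longrightarrow> tval e (nth1 zs i) \<le> tval e (nth1 zs j)) \<and>
    (\<forall>i\<in>{1..2^h-1}. \<forall>j\<in>{1..length ys}. tval e (nth1 ys j) \<le> tval e (nth1 zs i) \<longleftrightarrow> j \<in> f i)"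
proof -
  have fin: "finite {(i, j). (i, j) \<in> {1..a::nat} \<times> {1..b::nat} \<and> R i j}" for R a b
    by (rule finite_subset[of _ "{1..a} \<times> {1..b}"]) auto
  have pairs: "(\<forall>x\<in>{(i, j). (i, j) \<in> A \<times> B \<and> R i j}. sat e (case x of (i, j) \<Rightarrow> \<phi> i j)) \<longleftrightarrow>
      (\<forall>i\<in>A. \<forall>j\<in>B. R i j \<longrightarrow> sat e (\<phi> i j))" for A B :: "nat set" and R \<phi>
    by auto
  show ?thesis
    unfolding QQ_def sat.simps sat_Conjs[OF fin] sat_Conjs[OF finite_atLeastAtMost] pairs sat_LE
    by blast
qed

lemma sat_FF:
  "sat e (FF P Q k xs ys) \<longleftrightarrow>
    (sat e (Jirr (nth1 xs 1) (xs @ ys)) \<longrightarrow>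
     (\<forall>i\<in>{1..length ys}. sat e (At (nth1 ys i) (xs @ ys))) \<longrightarrow> sat e (P xs ys) \<longrightarrow>
     (\<exists>ps. length ps = k \<and> set ps \<subseteq> SS (length xs + length ys) \<and>
        sat e (Q xs ys (map (pLT (xs @ ys)) ps)) \<and>
        (\<forall>j\<in>{1..k}. sat e (Jirr (pLT (xs @ ys) (nth1 ps j)) (xs @ ys)))))"
proof -
  have "finite {ps. length ps = k \<and> set ps \<subseteq> SS N}" for N
    using finite_lists_length_eq[OF finite_SS] by (simp add: conj_commute)
  then show ?thesis by (auto simp: FF_def sat_Disjs sat_Conjs simp del: One_nat_def)
qed

text \<open>The premises of FS at a valuation with spectrum \<open>X\<close>: the variable \<open>x\<^sub>1\<close> is the principal down-set of
  \<open>q\<close>, the variable \<open>y\<^sub>j\<close> is the minimal point \<open>(\<tau> j, {\<tau> j})\<close>, and \<open>y\<^sub>1, \<dots>, y\<^sub>h\<close> are distinct and are those below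
  \<open>x\<^sub>1\<close>.\<close>
definition fan_base ::
    "point set \<Rightarrow> nat \<Rightarrow> nat \<Rightarrow> nat \<Rightarrow> point \<Rightarrow> (nat \<Rightarrow> nat set) \<Rightarrow> bool" where
  "fan_base X n m h q \<tau> \<longleftrightarrow> q \<in> X \<and> (\<forall>w\<in>X. 1 \<in> fst w \<longleftrightarrow> SS_le w q) \<and>
     (\<forall>j\<in>{1..m}. (\<tau> j, {\<tau> j}) \<in> X \<and> (\<forall>w\<in>X. n + j \<in> fst w \<longleftrightarrow> w = (\<tau> j, {\<tau> j})) \<and>
        (\<tau> j \<in> snd q \<longleftrightarrow> j \<le> h)) \<and>
     inj_on \<tau> {1..h}"

text \<open>The conclusion of FS, with \<open>r i\<close> the point whose down-set is \<open>z\<^sub>i\<close>.\<close>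
definition fan ::
    "point set \<Rightarrow> (nat \<Rightarrow> nat set) \<Rightarrow> nat \<Rightarrow> nat \<Rightarrow> point \<Rightarrow> (nat \<Rightarrow> nat set) \<Rightarrow> (nat \<Rightarrow> point) \<Rightarrow> bool"
  where
  "fan X f m h q \<tau> r \<longleftrightarrow>
     (\<forall>i\<in>{1..2^h-1}. r i \<in> X \<and> SS_le (r i) q \<and> (\<forall>j\<in>{1..m}. \<tau> j \<in> snd (r i) \<longleftrightarrow> j \<in> f i)) \<and>
     (\<forall>i\<in>{1..2^h-1}. \<forall>j\<in>{1..2^h-1}. f i \<subseteq> f j \<longrightarrow> SS_le (r i) (r j))"

text \<open>Every term in FS denotes a principal down-set of the spectrum, and inclusion of principal down-sets is the
  order of points; the rest is bookkeeping.\<close>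
lemma sat_FS:
  assumes n: "1 \<le> n" and h: "h \<le> m"
  shows "sat e (FS f h (xvars n) (yvars n m)) \<longleftrightarrow>
    (\<forall>q \<tau>. fan_base (spectrum (n + m) e) n m h q \<tau> \<longrightarrow>
       (\<exists>r. fan (spectrum (n + m) e) f m h q \<tau> r))"
proof -
  let ?N = "n + m" and ?X = "spectrum (n + m) e" and ?K = "{1..2^h-1::nat}"
  let ?p = "pLT (xvars ?N)"
  have app: "xvars n @ yvars n m = xvars ?N"
  proof -
    have "[1..<n + m + 1] = [1..<n + 1] @ [n + 1..<n + m + 1]"
      using upt_add_eq_append[of 1 "n + 1" m] by simp
    then show ?thesis by (simp add: xvars_def yvars_def del: upt_Suc)
  qed
  have ly: "length (yvars n m) = m" by (simp add: yvars_def)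
  have x1: "nth1 (xvars n) 1 = Var 1" using n by (intro nth1_xvars) simp
  have y: "nth1 (yvars n m) j = Var (n + j)" if "j \<in> {1..m}" for j
    using that by (auto simp: nth1_def yvars_def simp del: upt_Suc)
  have pts: "w \<in> points ?N" if "w \<in> ?X" for w
    using that spectrum_subset_points by blast
  have tv: "tvars (Var 1) \<subseteq> {1..?N}" "\<And>j. j \<in> {1..m} \<Longrightarrow> tvars (Var (n + j)) \<subseteq> {1..?N}"
    using n by auto
  have tp: "tvars (?p q) \<subseteq> {1..?N}" if "q \<in> SS ?N" for q
    using that by (intro tvars_pLT) (auto simp: SS_def)
  \<comment> \<open>The values of \<open>s\<close> and \<open>t\<close> correspond to principal down-sets of the spectrum.\<close>
  have le: "tval e s \<le> tval e t \<longleftrightarrow> SS_le a b"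
    if "tvars s \<subseteq> {1..?N}" "tvars t \<subseteq> {1..?N}" "a \<in> ?X"
      "\<forall>w\<in>?X. forces s w \<longleftrightarrow> SS_le w a" "\<forall>w\<in>?X. forces t w \<longleftrightarrow> SS_le w b" for s t a b
    using tval_le_iff_spectrum[OF that(1,2), of e] that(3-5) SS_le_trans SS_le_refl by blast
  have PP_iff: "sat e (PP h (xvars n) (yvars n m)) \<longleftrightarrow>
      (\<forall>j\<in>{1..m}. tval e (Var (n + j)) \<le> tval e (Var 1) \<longleftrightarrow> j \<le> h) \<and>
      inj_on (\<lambda>j. tval e (Var (n + j))) {1..h}"
    using h y by (auto simp: sat_PP ly x1 inj_on_def simp del: tval.simps One_nat_def)
  have base: "sat e (PP h (xvars n) (yvars n m)) \<longleftrightarrow>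
      (\<forall>j\<in>{1..m}. \<tau> j \<in> snd q \<longleftrightarrow> j \<le> h) \<and> inj_on \<tau> {1..h}"
    if q: "q \<in> ?X" "\<forall>w\<in>?X. 1 \<in> fst w \<longleftrightarrow> SS_le w q"
      and \<tau>: "\<forall>j\<in>{1..m}. (\<tau> j, {\<tau> j}) \<in> ?X \<and> (\<forall>w\<in>?X. n + j \<in> fst w \<longleftrightarrow> w = (\<tau> j, {\<tau> j}))" for q \<tau>
  proof -
    have fy: "\<forall>w\<in>?X. forces (Var (n + j)) w \<longleftrightarrow> SS_le w (\<tau> j, {\<tau> j})" if "j \<in> {1..m}" for j
      using \<tau> that le_atom[OF pts] by simp
    have "tval e (Var (n + j)) \<le> tval e (Var 1) \<longleftrightarrow> \<tau> j \<in> snd q" if j: "j \<in> {1..m}" for j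
      using le[OF tv(2)[OF j] tv(1) _ fy[OF j], of q] q \<tau> j atom_le_iff[OF pts[OF q(1)]] by simp
    moreover have "tval e (Var (n + j)) = tval e (Var (n + i)) \<longleftrightarrow> \<tau> j = \<tau> i"
      if ij: "i \<in> {1..h}" "j \<in> {1..h}" for i j
    proof -
      have m: "i \<in> {1..m}" "j \<in> {1..m}" using ij h by auto
      have "tval e (Var (n + j)) = tval e (Var (n + i)) \<longleftrightarrow>
          SS_le (\<tau> j, {\<tau> j}) (\<tau> i, {\<tau> i}) \<and> SS_le (\<tau> i, {\<tau> i}) (\<tau> j, {\<tau> j})"
        unfolding order.eq_iff
        using le[OF tv(2)[OF m(2)] tv(2)[OF m(1)] _ fy[OF m(2)] fy[OF m(1)]]
          le[OF tv(2)[OF m(1)] tv(2)[OF m(2)] _ fy[OF m(1)] fy[OF m(2)]] \<tau> m by simp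
      then show ?thesis by (auto simp: SS_le_iff)
    qed
    ultimately show ?thesis unfolding PP_iff inj_on_def by auto
  qed
  have QQ_iff: "sat e (QQ f h (xvars n) (yvars n m) (map ?p ps)) \<longleftrightarrow> fan ?X f m h q \<tau> r"
    if q: "q \<in> ?X" "\<forall>w\<in>?X. 1 \<in> fst w \<longleftrightarrow> SS_le w q"
      and \<tau>: "\<forall>j\<in>{1..m}. (\<tau> j, {\<tau> j}) \<in> ?X \<and> (\<forall>w\<in>?X. n + j \<in> fst w \<longleftrightarrow> w = (\<tau> j, {\<tau> j}))"
      and ps: "length ps = 2^h-1" "set ps \<subseteq> SS ?N"
      and r: "\<forall>i\<in>?K. r i \<in> ?X \<and> (\<forall>w\<in>?X. forces (?p (nth1 ps i)) w \<longleftrightarrow> SS_le w (r i))"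
    for q \<tau> ps r
  proof -
    have z: "nth1 (map ?p ps) i = ?p (nth1 ps i)" "nth1 ps i \<in> SS ?N" if "i \<in> ?K" for i
      using that ps by (auto simp: nth1_def)
    have tz: "tvars (?p (nth1 ps i)) \<subseteq> {1..?N}" if "i \<in> ?K" for i
      using tp z(2)[OF that] .
    have fy: "\<forall>w\<in>?X. forces (Var (n + j)) w \<longleftrightarrow> SS_le w (\<tau> j, {\<tau> j})" if "j \<in> {1..m}" for j
      using \<tau> that le_atom[OF pts] by simp
    have fx: "\<forall>w\<in>?X. forces (Var 1) w \<longleftrightarrow> SS_le w q" using q by simp
    have 1: "tval e (nth1 (map ?p ps) i) \<le> tval e (nth1 (xvars n) 1) \<longleftrightarrow> SS_le (r i) q"
      if i: "i \<in> ?K" for i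
      unfolding x1 z(1)[OF i] using r i by (intro le[OF tz[OF i] tv(1) _ _ fx]) auto
    have 2: "tval e (nth1 (map ?p ps) i) \<le> tval e (nth1 (map ?p ps) j) \<longleftrightarrow> SS_le (r i) (r j)"
      if i: "i \<in> ?K" "j \<in> ?K" for i j
      unfolding z(1)[OF i(1)] z(1)[OF i(2)] using r i by (intro le[OF tz tz]) auto
    have 3: "tval e (nth1 (yvars n m) j) \<le> tval e (nth1 (map ?p ps) i) \<longleftrightarrow> \<tau> j \<in> snd (r i)"
      if i: "i \<in> ?K" and j: "j \<in> {1..m}" for i j
    proof -
      have "tval e (nth1 (yvars n m) j) \<le> tval e (nth1 (map ?p ps) i) \<longleftrightarrow> SS_le (\<tau> j, {\<tau> j}) (r i)"
        unfolding y[OF j] z(1)[OF i] using r i j \<tau>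
        by (intro le[OF tv(2)[OF j] tz[OF i] _ fy[OF j]]) auto
      then show ?thesis using atom_le_iff[OF pts] r i by simp
    qed
    have 1: "(\<forall>i\<in>?K. tval e (nth1 (map ?p ps) i) \<le> tval e (nth1 (xvars n) 1)) \<longleftrightarrow>
        (\<forall>i\<in>?K. SS_le (r i) q)"
      using 1 by blast
    have 2: "(\<forall>i\<in>?K. \<forall>j\<in>?K. f i \<subseteq> f j \<longrightarrow>
          tval e (nth1 (map ?p ps) i) \<le> tval e (nth1 (map ?p ps) j)) \<longleftrightarrow>
        (\<forall>i\<in>?K. \<forall>j\<in>?K. f i \<subseteq> f j \<longrightarrow> SS_le (r i) (r j))"
      using 2 by blast
    have 3: "(\<forall>i\<in>?K. \<forall>j\<in>{1..m}.
          tval e (nth1 (yvars n m) j) \<le> tval e (nth1 (map ?p ps) i) \<longleftrightarrow> j \<in> f i) \<longleftrightarrow>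
        (\<forall>i\<in>?K. \<forall>j\<in>{1..m}. \<tau> j \<in> snd (r i) \<longleftrightarrow> j \<in> f i)"
      using 3 by blast
    show ?thesis
      unfolding sat_QQ ly fan_def 1 2 3 using r by blast
  qed
  show ?thesis
  proof (intro iffI allI impI)
    fix q \<tau>
    assume S: "sat e (FS f h (xvars n) (yvars n m))" and B: "fan_base ?X n m h q \<tau>"
    then have q: "q \<in> ?X" "\<forall>w\<in>?X. 1 \<in> fst w \<longleftrightarrow> SS_le w q"
      and \<tau>: "\<forall>j\<in>{1..m}. (\<tau> j, {\<tau> j}) \<in> ?X \<and> (\<forall>w\<in>?X. n + j \<in> fst w \<longleftrightarrow> w = (\<tau> j, {\<tau> j}))"
      and \<tau>': "(\<forall>j\<in>{1..m}. \<tau> j \<in> snd q \<longleftrightarrow> j \<le> h) \<and> inj_on \<tau> {1..h}"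
      unfolding fan_base_def by blast+
    have "sat e (Jirr (Var 1) (xvars ?N))"
      unfolding sat_Jirr[OF tv(1)] using q SS_le_refl[of q] by (auto simp del: SS_le_refl)
    moreover have "\<forall>i\<in>{1..m}. sat e (At (nth1 (yvars n m) i) (xvars ?N))"
      using \<tau> y by (auto simp: sat_At[OF tv(2)] simp del: One_nat_def)
    moreover have "sat e (PP h (xvars n) (yvars n m))" using base[OF q \<tau>] \<tau>' by simp
    ultimately obtain ps where ps: "length ps = 2^h-1" "set ps \<subseteq> SS ?N"
        "sat e (QQ f h (xvars n) (yvars n m) (map ?p ps))"
        "\<forall>j\<in>?K. sat e (Jirr (?p (nth1 ps j)) (xvars ?N))"
      using S by (auto simp: FS_def sat_FF app x1 ly simp del: One_nat_def)
    have "\<forall>i\<in>?K. \<exists>w'\<in>?X. \<forall>w\<in>?X. forces (?p (nth1 ps i)) w \<longleftrightarrow> SS_le w w'"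
    proof
      fix i assume i: "i \<in> ?K"
      have "nth1 ps i \<in> SS ?N" using i ps(1,2) by (auto simp: nth1_def)
      from sat_Jirr[OF tp[OF this]] ps(4) i
      show "\<exists>w'\<in>?X. \<forall>w\<in>?X. forces (?p (nth1 ps i)) w \<longleftrightarrow> SS_le w w'" by blast
    qed
    then obtain r where
      "\<forall>i\<in>?K. r i \<in> ?X \<and> (\<forall>w\<in>?X. forces (?p (nth1 ps i)) w \<longleftrightarrow> SS_le w (r i))"
      by metis
    from QQ_iff[OF q \<tau> ps(1,2) this] ps(3) show "\<exists>r. fan ?X f m h q \<tau> r" by blast
  next
    assume H: "\<forall>q \<tau>. fan_base ?X n m h q \<tau> \<longrightarrow> (\<exists>r. fan ?X f m h q \<tau> r)"
    show "sat e (FS f h (xvars n) (yvars n m))"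
      unfolding FS_def sat_FF app x1 ly length_xvars
    proof (intro impI)
      assume J: "sat e (Jirr (Var 1) (xvars ?N))"
        and A: "\<forall>i\<in>{1..m}. sat e (At (nth1 (yvars n m) i) (xvars ?N))"
        and P: "sat e (PP h (xvars n) (yvars n m))"
      from J obtain q where q: "q \<in> ?X" "\<forall>w\<in>?X. 1 \<in> fst w \<longleftrightarrow> SS_le w q"
        unfolding sat_Jirr[OF tv(1)] by auto
      have "\<forall>j\<in>{1..m}. \<exists>T. (T, {T}) \<in> ?X \<and> (\<forall>w\<in>?X. n + j \<in> fst w \<longleftrightarrow> w = (T, {T}))"
      proof
        fix j assume j: "j \<in> {1..m}"
        with A y have "sat e (At (Var (n + j)) (xvars ?N))" by metis
        then show "\<exists>T. (T, {T}) \<in> ?X \<and> (\<forall>w\<in>?X. n + j \<in> fst w \<longleftrightarrow> w = (T, {T}))"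
          unfolding sat_At[OF tv(2)[OF j]] by simp
      qed
      then obtain \<tau> where
        \<tau>: "\<forall>j\<in>{1..m}. (\<tau> j, {\<tau> j}) \<in> ?X \<and> (\<forall>w\<in>?X. n + j \<in> fst w \<longleftrightarrow> w = (\<tau> j, {\<tau> j}))"
        by metis
      have "fan_base ?X n m h q \<tau>"
        using q \<tau> base[OF q \<tau>] P unfolding fan_base_def by blast
      then obtain r where r: "fan ?X f m h q \<tau> r" using H by blast
      define ps where "ps = map r [1..<2^h]"
      have nth: "nth1 ps i = r i" if "i \<in> ?K" for i
        using that by (auto simp: nth1_def ps_def)
      have rX: "r i \<in> ?X" "r i \<in> points ?N" "fst (r i) \<noteq> {}" if "i \<in> ?K" for i
      proof -
        show *: "r i \<in> ?X" using r that unfolding fan_def by blast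
        then show "r i \<in> points ?N" by (rule pts)
        have "SS_le (r i) q" using r that unfolding fan_def by blast
        then show "fst (r i) \<noteq> {}" using q(2) * by auto
      qed
      have len: "length ps = 2^h-1" by (simp add: ps_def)
      obtain M :: nat where "2^h = Suc M" using not0_implies_Suc[of "2^h"] by auto
      then have "set [1..<2^h] = ?K"
        by (simp only: set_upt atLeastLessThanSuc_atLeastAtMost diff_Suc_1)
      then have "set ps = r ` ?K" unfolding ps_def set_map by (rule arg_cong)
      moreover have "r ` ?K \<subseteq> SS ?N"
        by (rule image_subsetI, rule points_in_SS[OF rX(2,3)])
      ultimately have sub: "set ps \<subseteq> SS ?N" by simp
      have fr: "forces (?p (r i)) w \<longleftrightarrow> SS_le w (r i)" if "i \<in> ?K" "w \<in> ?X" for i w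
        using forces_pLT_points[OF pts[OF that(2)] rX(2)[OF that(1)]] .
      have r': "\<forall>i\<in>?K. r i \<in> ?X \<and> (\<forall>w\<in>?X. forces (?p (nth1 ps i)) w \<longleftrightarrow> SS_le w (r i))"
        using rX(1) fr nth by simp
      have "sat e (Jirr (?p (nth1 ps i)) (xvars ?N))" if i: "i \<in> ?K" for i
        unfolding nth[OF i] sat_Jirr[OF tvars_pLT_points[OF rX(2)[OF i]]]
        using rX[OF i] fr[OF i] by blast
      moreover have "sat e (QQ f h (xvars n) (yvars n m) (map ?p ps))"
        using QQ_iff[OF q \<tau> len sub r'] r by blast
      ultimately show "\<exists>ps. length ps = 2^h-1 \<and> set ps \<subseteq> SS ?N \<and>
          sat e (QQ f h (xvars n) (yvars n m) (map ?p ps)) \<and>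
          (\<forall>j\<in>?K. sat e (Jirr (?p (nth1 ps j)) (xvars ?N)))"
        using len sub by blast
    qed
  qed
qed

section \<open>The free algebra satisfies the axioms\<close>

primrec subst :: "(nat \<Rightarrow> trm) \<Rightarrow> trm \<Rightarrow> trm" where
  "subst \<sigma> (Var i) = \<sigma> i"
| "subst \<sigma> Zero = Zero"
| "subst \<sigma> One = One"
| "subst \<sigma> (Meet s t) = Meet (subst \<sigma> s) (subst \<sigma> t)"
| "subst \<sigma> (Join s t) = Join (subst \<sigma> s) (subst \<sigma> t)"
| "subst \<sigma> (Neg t) = Neg (subst \<sigma> t)"

abbreviation shift :: "trm \<Rightarrow> trm" where
  "shift \<equiv> subst (\<lambda>i. Var (Suc i))"

lemma tval_subst: "tval e (subst \<sigma> t) = tval (\<lambda>i. tval e (\<sigma> i)) t"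
  by (induction t) auto

lemma tvars_shift: "tvars (shift t) = Suc ` tvars t"
  by (induction t) auto

lemma finite_tvars: "finite (tvars t)"
  by (induction t) auto

lemma finite_fvars: "finite (fvars \<phi>)"
  by (induction \<phi>) (auto simp: finite_tvars)

lemma sat_cong:
  assumes "\<And>s t. tvars s \<subseteq> V \<Longrightarrow> tvars t \<subseteq> V \<Longrightarrow> tval e s = tval e t \<longleftrightarrow> tval d s = tval d t"
    and "qfree \<phi>" "fvars \<phi> \<subseteq> V"
  shows "sat e \<phi> \<longleftrightarrow> sat d \<phi>"
  using assms(2,3) by (induction \<phi>) (use assms(1) in auto)

text \<open>Spectra see only the variables from 1 on, but elements of the free algebra may involve the generator of
  index 0. Renaming the generators by the successor map preserves and reflects equality, since
  it is undone by a homomorphism.\<close>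
lemma tval_gen_shift_eq_iff:
  "tval gen (shift s) = tval gen (shift t) \<longleftrightarrow> tval gen s = tval gen t"
proof
  assume "tval gen (shift s) = tval gen (shift t)"
  then have "pdl_eq (shift s) (shift t)" by (simp add: tval_gen free_pdl.abs_eq_iff)
  from pdl_eq_sound[OF this, of "\<lambda>i. gen (i - 1)"] show "tval gen s = tval gen t"
    by (simp add: tval_subst)
next
  assume "tval gen s = tval gen t"
  then have "pdl_eq s t" by (simp add: tval_gen free_pdl.abs_eq_iff)
  from pdl_eq_sound[OF this, of "\<lambda>i. gen (Suc i)"]
  show "tval gen (shift s) = tval gen (shift t)" by (simp add: tval_subst)
qed

lemma sat_free_pdl_if:
  fixes \<phi> :: fm
  assumes qf: "qfree \<phi>"
    and sat: "\<And>\<sigma>. (\<And>i. 0 \<notin> tvars (\<sigma> i)) \<Longrightarrow> sat (\<lambda>i. tval gen (\<sigma> i)) \<phi>"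
  shows "sat (e :: nat \<Rightarrow> free_pdl) \<phi>"
proof -
  have "\<forall>i. \<exists>t. e i = tval gen t" using free_pdl_term by metis
  then obtain \<tau> where \<tau>: "e = (\<lambda>i. tval gen (\<tau> i))" by metis
  have eq: "tval (\<lambda>i. tval gen (shift (\<tau> i))) t = tval gen (shift (subst \<tau> t))" for t
    by (induction t) auto
  have "sat (\<lambda>i. tval gen (shift (\<tau> i))) \<phi>"
    by (rule sat) (auto simp: tvars_shift)
  moreover have "sat e \<phi> \<longleftrightarrow> sat (\<lambda>i. tval gen (shift (\<tau> i))) \<phi>"
  proof (rule sat_cong[OF _ qf, of UNIV])
    have "tval e t = tval gen (subst \<tau> t)" for t by (simp add: \<tau> tval_subst)
    then show "tval e s = tval e t \<longleftrightarrow>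
        tval (\<lambda>i. tval gen (shift (\<tau> i))) s = tval (\<lambda>i. tval gen (shift (\<tau> i))) t" for s t
      unfolding eq tval_gen_shift_eq_iff by simp
  qed simp
  ultimately show ?thesis by blast
qed

text \<open>Finitely many elements of the free algebra involve only finitely many generators, so a spectrum there is a
  \<open>pull\<close> image of some \<open>points M\<close>.\<close>
lemma spectrum_gen_terms:
  assumes "\<And>i. 0 \<notin> tvars (\<sigma> i)"
  obtains M where "spectrum N (\<lambda>i. tval gen (\<sigma> i)) = pull N \<sigma> ` points M"
proof -
  have "finite (\<Union>i\<in>{1..N}. tvars (\<sigma> i))" by (simp add: finite_tvars)
  then obtain M where M: "\<And>k. k \<in> (\<Union>i\<in>{1..N}. tvars (\<sigma> i)) \<Longrightarrow> k \<le> M"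
    unfolding finite_nat_set_iff_bounded_le by blast
  have "tvars (\<sigma> i) \<subseteq> {1..M}" if "i \<in> {1..N}" for i
  proof
    fix k assume "k \<in> tvars (\<sigma> i)"
    then have "k \<le> M" using M that by blast
    moreover have "k \<noteq> 0" using \<open>k \<in> tvars (\<sigma> i)\<close> assms[of i] by (cases k) auto
    ultimately show "k \<in> {1..M}" by simp
  qed
  then have "spectrum N (\<lambda>i. tval gen (\<sigma> i)) = pull N \<sigma> ` points M"
    using spectrum_substitution[of N "\<lambda>i. tval gen (\<sigma> i)" gen \<sigma> M] by (simp add: spectrum_gen)
  then show thesis by (rule that)
qed

text \<open>If \<open>q\<close> is the image of \<open>(L, \<T>)\<close>, then shrink \<open>\<T>\<close> to the sets that are mapped to some \<open>\<tau> j\<close> with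
  \<open>j \<in> f i\<close> and keep \<open>L\<close>: the image of the resulting point is \<open>r i\<close>.\<close>
lemma fan_exists_pull:
  assumes base: "fan_base (pull N \<sigma> ` points M) n m h q \<tau>"
    and f: "f ` {1..2^h-1} \<subseteq> Pow {1..h} - {{}}" and h: "h \<le> m"
  shows "\<exists>r. fan (pull N \<sigma> ` points M) f m h q \<tau> r"
proof -
  let ?c = "\<lambda>T. {i\<in>{1..N}. forces (\<sigma> i) (T, {T})}"
  obtain q0 where q0: "q0 \<in> points M" "q = pull N \<sigma> q0"
    using base by (auto simp: fan_base_def)
  have snd_q: "snd q = ?c ` snd q0" by (simp add: q0 pull_def)
  have \<tau>: "\<tau> j \<in> snd q \<longleftrightarrow> j \<le> h" if "j \<in> {1..m}" for j
    using base that unfolding fan_base_def by blast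
  have inj: "inj_on \<tau> {1..h}" using base unfolding fan_base_def by blast
  define r0 where "r0 i = (fst q0, {T\<in>snd q0. ?c T \<in> \<tau> ` f i})" for i
  define r where "r i = pull N \<sigma> (r0 i)" for i
  have snd_r: "snd (r i) = snd q \<inter> \<tau> ` f i" for i
    by (auto simp: r_def r0_def snd_q pull_def)
  have fi: "f i \<subseteq> {1..h}" "f i \<noteq> {}" if "i \<in> {1..2^h-1}" for i
    using f that by blast+
  have "r i \<in> pull N \<sigma> ` points M \<and> SS_le (r i) q \<and> (\<forall>j\<in>{1..m}. \<tau> j \<in> snd (r i) \<longleftrightarrow> j \<in> f i)"
    if i: "i \<in> {1..2^h-1}" for i
  proof (intro conjI ballI)
    obtain j where j: "j \<in> f i" using fi[OF i] by blast
    then have "j \<in> {1..m}" "j \<le> h" using fi[OF i] h by auto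
    then have "\<tau> j \<in> snd (r i)" using \<tau> j by (simp add: snd_r)
    then have "snd (r0 i) \<noteq> {}" by (auto simp: r_def pull_def)
    then have "r0 i \<in> points M" using q0(1) by (auto simp: points_def r0_def)
    then show "r i \<in> pull N \<sigma> ` points M" by (simp add: r_def)
    have "SS_le (r0 i) q0" by (auto simp: r0_def SS_le_iff)
    then show "SS_le (r i) q" unfolding r_def q0(2) by (rule pull_mono)
  next
    fix j assume j: "j \<in> {1..m}"
    show "\<tau> j \<in> snd (r i) \<longleftrightarrow> j \<in> f i"
    proof
      assume "\<tau> j \<in> snd (r i)"
      then obtain k where k: "k \<in> f i" "\<tau> j = \<tau> k" and "j \<le> h"
        using \<tau>[OF j] by (auto simp: snd_r)
      then have "j = k" using inj fi(1)[OF i] j by (auto dest: inj_onD)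
      then show "j \<in> f i" using k by simp
    next
      assume "j \<in> f i"
      then show "\<tau> j \<in> snd (r i)" using \<tau>[OF j] fi(1)[OF i] by (auto simp: snd_r)
    qed
  qed
  moreover have "SS_le (r i) (r j)" if "f i \<subseteq> f j" for i j
  proof -
    have "SS_le (r0 i) (r0 j)" using that by (auto simp: r0_def SS_le_iff)
    then show ?thesis unfolding r_def by (rule pull_mono)
  qed
  ultimately have "fan (pull N \<sigma> ` points M) f m h q \<tau> r" unfolding fan_def by blast
  then show ?thesis by blast
qed

lemma qfree_Conjs: "(\<And>i. qfree (\<phi> i)) \<Longrightarrow> qfree (Conjs I \<phi>)"
proof -
  assume q: "\<And>i. qfree (\<phi> i)"
  have "qfree (foldr AND (map \<phi> is) (EQ Zero Zero))" for "is"
    using q by (induction "is") auto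
  then show ?thesis by (simp add: Conjs_def)
qed

lemma qfree_Disjs: "(\<And>i. qfree (\<phi> i)) \<Longrightarrow> qfree (Disjs I \<phi>)"
proof -
  assume q: "\<And>i. qfree (\<phi> i)"
  have "qfree (foldr OR (map \<phi> is) (NOT (EQ Zero Zero)))" for "is"
    using q by (induction "is") auto
  then show ?thesis by (simp add: Disjs_def)
qed

lemma qfree_FS: "qfree (FS f h xs ys)"
  unfolding FS_def FF_def Jirr_def At_def PP_def PP0_def QQ_def LE_def
  by (auto intro!: qfree_Conjs qfree_Disjs simp del: One_nat_def split: prod.split)

lemma free_pdl_FS:
  fixes e :: "nat \<Rightarrow> free_pdl"
  assumes "1 \<le> n" "h \<le> m" and f: "f ` {1..2^h-1} \<subseteq> Pow {1..h} - {{}}"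
  shows "sat e (FS f h (xvars n) (yvars n m))"
proof (rule sat_free_pdl_if[OF qfree_FS])
  fix \<sigma> :: "nat \<Rightarrow> trm" assume \<sigma>: "\<And>i. 0 \<notin> tvars (\<sigma> i)"
  obtain M where M: "spectrum (n + m) (\<lambda>i. tval gen (\<sigma> i)) = pull (n + m) \<sigma> ` points M"
    by (rule spectrum_gen_terms[OF \<sigma>])
  show "sat (\<lambda>i. tval gen (\<sigma> i)) (FS f h (xvars n) (yvars n m))"
    unfolding sat_FS[OF assms(1,2)] M by (intro allI impI fan_exists_pull f assms(2))
qed

lemma free_pdl_DN:
  fixes e :: "nat \<Rightarrow> free_pdl"
  shows "sat e (DN (Var 1) (Var 2) (Var 3))"
proof (rule sat_free_pdl_if)
  show "qfree (DN (Var 1) (Var 2) (Var 3))" by (simp add: DN_def)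
  fix \<sigma> :: "nat \<Rightarrow> trm" assume \<sigma>: "\<And>i. 0 \<notin> tvars (\<sigma> i)"
  let ?d = "\<lambda>i. tval gen (\<sigma> i)"
  let ?x = "Neg (Neg (Var 1))"
  obtain M where M: "spectrum 3 ?d = pull 3 \<sigma> ` points M"
    by (rule spectrum_gen_terms[OF \<sigma>])
  have eq: "tval ?d s = tval ?d t \<longleftrightarrow> (\<forall>q\<in>points M. forces s (pull 3 \<sigma> q) \<longleftrightarrow> forces t (pull 3 \<sigma> q))"
    if "tvars s \<subseteq> {1..3}" "tvars t \<subseteq> {1..3}" for s t
    using tval_eq_iff_spectrum[OF that, of ?d] M by simp
  show "sat ?d (DN (Var 1) (Var 2) (Var 3))"
  proof (rule ccontr)
    assume "\<not> ?thesis"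
    then have *: "tval ?d ?x = tval ?d (Join (Var 2) (Var 3))"
      and ne: "tval ?d (Var 2) \<noteq> tval ?d ?x" "tval ?d (Var 3) \<noteq> tval ?d ?x"
      by (auto simp: DN_def)
    have J: "forces ?x (pull 3 \<sigma> q) \<longleftrightarrow>
        forces (Var 2) (pull 3 \<sigma> q) \<or> forces (Var 3) (pull 3 \<sigma> q)" if "q \<in> points M" for q
      using * eq[of ?x "Join (Var 2) (Var 3)"] that by simp
    obtain q1 where q1: "q1 \<in> points M" "forces ?x (pull 3 \<sigma> q1)" "\<not> forces (Var 2) (pull 3 \<sigma> q1)"
    proof -
      have "\<not> (\<forall>q\<in>points M. forces (Var 2) (pull 3 \<sigma> q) \<longleftrightarrow> forces ?x (pull 3 \<sigma> q))"
        using ne(1) eq[of "Var 2" ?x] by (simp del: forces.simps)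
      then show thesis using that J by blast
    qed
    obtain q2 where q2: "q2 \<in> points M" "forces ?x (pull 3 \<sigma> q2)" "\<not> forces (Var 3) (pull 3 \<sigma> q2)"
    proof -
      have "\<not> (\<forall>q\<in>points M. forces (Var 3) (pull 3 \<sigma> q) \<longleftrightarrow> forces ?x (pull 3 \<sigma> q))"
        using ne(2) eq[of "Var 3" ?x] by (simp del: forces.simps)
      then show thesis using that J by blast
    qed
    \<comment> \<open>This common upper bound forces \<open>\<not>\<not>x\<close>, hence \<open>y\<close> or \<open>z\<close>, which then persists to \<open>q1\<close> and \<open>q2\<close>.\<close>
    define q where "q = ({} :: nat set, snd q1 \<union> snd q2)"
    have q: "q \<in> points M" using q1(1) q2(1) by (auto simp: points_def q_def)
    have le: "SS_le (pull 3 \<sigma> q1) (pull 3 \<sigma> q)" "SS_le (pull 3 \<sigma> q2) (pull 3 \<sigma> q)"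
      by (rule pull_mono, simp add: SS_le_iff q_def)+
    have "snd (pull 3 \<sigma> q) = snd (pull 3 \<sigma> q1) \<union> snd (pull 3 \<sigma> q2)"
      by (simp add: pull_def q_def image_Un)
    then have "forces ?x (pull 3 \<sigma> q)" using q1(2) q2(2) by auto
    then show False using J[OF q] q1(3) q2(3) forces_mono[OF le(1)] forces_mono[OF le(2)] by blast
  qed
qed

lemma free_pdl_nontrivial: "(bot :: free_pdl) \<noteq> top"
proof
  assume "(bot :: free_pdl) = top"
  then have "tval gen Zero = tval gen One" by simp
  then have "pdl_eq Zero One" by (simp only: tval_gen free_pdl.abs_eq_iff)
  then show False using forces_pdl_eq[of Zero One "({}, {{}})"] by simp
qed

lemma universal_sentence_closure:
  assumes "qfree \<phi>"
  shows "universal_sentence (universal_closure \<phi>)"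
proof -
  have "fvars (foralls is \<phi>) = fvars \<phi> - set is" for "is"
    by (induction "is") (auto simp: foralls_def)
  then show ?thesis
    using assms unfolding universal_sentence_def universal_closure_def
    by (auto simp: finite_fvars)
qed

lemma Sigma_axioms_in_Th_free:
  assumes f: "\<And>h. 1 \<le> h \<Longrightarrow> bij_betw (f h) {1..2^h-1} (Pow {1..h} - {{}})"
  shows "Sigma_axioms f \<subseteq> Th_univ TYPE(free_pdl)"
proof
  fix \<phi> assume "\<phi> \<in> Sigma_axioms f"
  then consider "\<phi> = universal_closure (NOT (EQ Zero One))"
    | "\<phi> = universal_closure (DN (Var 1) (Var 2) (Var 3))"
    | n m h where "\<phi> = universal_closure (FS (f h) h (xvars n) (yvars n m))" "1 \<le> n" "1 \<le> h" "h \<le> m"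
    unfolding Sigma_axioms_def by blast
  then show "\<phi> \<in> Th_univ TYPE(free_pdl)"
  proof cases
    case 1
    then show ?thesis
      by (simp add: Th_univ_def universal_sentence_closure models_universal_closure free_pdl_nontrivial)
  next
    case 2
    have "qfree (DN (Var 1) (Var 2) (Var 3))" by (simp add: DN_def)
    then show ?thesis
      using free_pdl_DN by (simp add: 2 Th_univ_def universal_sentence_closure models_universal_closure)
  next
    case 3
    have "f h ` {1..2^h-1} \<subseteq> Pow {1..h} - {{}}"
      using f[OF 3(3)] by (simp add: bij_betw_def)
    then show ?thesis
      using free_pdl_FS[OF 3(2,4)] qfree_FS
      by (simp add: 3(1) Th_univ_def universal_sentence_closure models_universal_closure)
  qed
qed

section \<open>Spectra in models of the axioms\<close>

lemma DN_join_list: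
  fixes e :: "nat \<Rightarrow> 'a::pdl"
  assumes DN: "\<And>x y z :: 'a. - (- x) = sup y z \<Longrightarrow> y = - (- x) \<or> z = - (- x)"
    and "- (- x) = tval e (foldr Join ts Zero)"
  shows "- (- x) = bot \<or> (\<exists>t\<in>set ts. - (- x) = tval e t)"
  using assms(2)
proof (induction ts)
  case (Cons t ts)
  then have "tval e t = - (- x) \<or> tval e (foldr Join ts Zero) = - (- x)"
    by (intro DN) simp
  with Cons.IH show ?case by fastforce
qed simp

text \<open>Let \<open>w\<close> be the join of the \<open>a\<^sub>T\<close> with \<open>T \<in> S\<close>. Then \<open>\<not>\<not>w\<close> is forced at the points \<open>q\<close> with
  \<open>snd q \<subseteq> S\<close>, so it is the join of the corresponding \<open>p\<^sub>q\<close>. By DN it equals one of them, and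
  the point of that one is the largest.\<close>
lemma spectrum_greatest_over:
  fixes e :: "nat \<Rightarrow> 'a::pdl"
  assumes DN: "\<And>x y z :: 'a. - (- x) = sup y z \<Longrightarrow> y = - (- x) \<or> z = - (- x)"
    and S: "S \<noteq> {}" "S \<subseteq> {T. (T, {T}) \<in> spectrum N e}"
  shows "\<exists>z\<in>spectrum N e. snd z = S \<and> (\<forall>q\<in>spectrum N e. snd q \<subseteq> S \<longrightarrow> SS_le q z)"
proof -
  let ?X = "spectrum N e"
  have pts: "q \<in> points N" if "q \<in> ?X" for q using that spectrum_subset_points by blast
  have S_sub: "T \<subseteq> {1..N}" if "T \<in> S" for T
    using fst_points[OF pts, of "(T, {T})"] that S(2) by auto
  have finS: "finite S" using S_sub by (intro finite_subset[of S "Pow {1..N}"]) auto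
  define w where "w = Joins S (aT (xvars N))"
  have tw: "tvars w \<subseteq> {1..N}"
    unfolding w_def tvars_Joins[OF finS] using tvars_aT[OF S_sub] by blast
  have fw: "forces (Neg (Neg w)) q \<longleftrightarrow> snd q \<subseteq> S" if q: "q \<in> points N" for q
  proof -
    have "forces w (T, {T}) \<longleftrightarrow> T \<in> S" if "T \<in> snd q" for T
      using forces_aT[OF atom_in_points[OF q that] S_sub] by (auto simp: w_def forces_Joins[OF finS])
    then show ?thesis by auto
  qed
  define Y where "Y = {q\<in>?X. snd q \<subseteq> S}"
  have "Y \<subseteq> points N" using pts by (auto simp: Y_def)
  then have finY: "finite Y" by (rule finite_subset[OF _ finite_points])
  have tY: "tvars (Joins Y (pLT (xvars N))) \<subseteq> {1..N}"
    unfolding tvars_Joins[OF finY] using tvars_pLT_points pts by (force simp: Y_def)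
  have fY: "forces (pLT (xvars N) r) q \<longleftrightarrow> SS_le q r" if "q \<in> ?X" "r \<in> ?X" for q r
    using forces_pLT_points[OF pts[OF that(1)] pts[OF that(2)]] .
  have "forces (Joins Y (pLT (xvars N))) q \<longleftrightarrow> snd q \<subseteq> S" if q: "q \<in> ?X" for q
  proof -
    have "forces (Joins Y (pLT (xvars N))) q \<longleftrightarrow> (\<exists>r\<in>Y. SS_le q r)"
      unfolding forces_Joins[OF finY] using fY[OF q] by (auto simp: Y_def)
    also have "\<dots> \<longleftrightarrow> snd q \<subseteq> S"
    proof
      assume "snd q \<subseteq> S"
      then have "q \<in> Y" using q by (simp add: Y_def)
      then show "\<exists>r\<in>Y. SS_le q r" using SS_le_refl by blast
    qed (auto simp: Y_def SS_le_iff)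
    finally show ?thesis .
  qed
  then have "tval e (Neg (Neg w)) = tval e (Joins Y (pLT (xvars N)))"
    using tval_eq_iff_spectrum[of "Neg (Neg w)" N _ e] tw tY fw pts by simp
  then have "- (- tval e w) = tval e (foldr Join (map (pLT (xvars N)) (enum_of Y)) Zero)"
    by (simp add: Joins_def)
  from DN_join_list[OF DN this]
  consider "- (- tval e w) = bot" | z where "z \<in> Y" "- (- tval e w) = tval e (pLT (xvars N) z)"
    using finY by auto
  then show ?thesis
  proof cases
    case 1
    obtain T where "T \<in> S" using S by blast
    then have T: "(T, {T}) \<in> ?X" using S by blast
    have "tval e (Neg (Neg w)) = tval e Zero" using 1 by simp
    then have "\<not> forces (Neg (Neg w)) (T, {T})"
      using tval_eq_iff_spectrum[of "Neg (Neg w)" N Zero e] tw T by auto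
    then show ?thesis using fw[OF pts[OF T]] \<open>T \<in> S\<close> by simp
  next
    case 2
    have zX: "z \<in> ?X" "snd z \<subseteq> S" using 2(1) by (simp_all add: Y_def)
    have "tval e (Neg (Neg w)) = tval e (pLT (xvars N) z)" using 2(2) by simp
    then have all: "\<forall>q\<in>?X. forces (Neg (Neg w)) q \<longleftrightarrow> forces (pLT (xvars N) z) q"
      using tval_eq_iff_spectrum[of "Neg (Neg w)" N "pLT (xvars N) z" e] tw
        tvars_pLT_points[OF pts[OF zX(1)]] by simp
    have max: "SS_le q z" if "q \<in> ?X" "snd q \<subseteq> S" for q
      using all fw[OF pts] fY[OF _ zX(1)] that by blast
    have "T \<in> snd z" if "T \<in> S" for T
    proof -
      have T: "(T, {T}) \<in> ?X" using S that by blast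
      have "SS_le (T, {T}) z" using max[OF T] that by simp
      then show ?thesis by (simp add: SS_le_iff)
    qed
    then show ?thesis using max zX by blast
  qed
qed

text \<open>The combinatorial content of FS at \<open>q\<close>, free of variables and of the numbering \<open>f\<close>: the family is indexed
  by the sets of minimal points themselves.\<close>
definition full_fan :: "point set \<Rightarrow> point \<Rightarrow> (nat set set \<Rightarrow> point) \<Rightarrow> bool" where
  "full_fan X q \<zeta> \<longleftrightarrow>
     (\<forall>S. S \<noteq> {} \<and> S \<subseteq> snd q \<longrightarrow> \<zeta> S \<in> X \<and> SS_le (\<zeta> S) q \<and> snd (\<zeta> S) = S) \<and>
     (\<forall>S S'. S \<noteq> {} \<and> S \<subseteq> S' \<and> S' \<subseteq> snd q \<longrightarrow> SS_le (\<zeta> S) (\<zeta> S'))"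

text \<open>FS speaks of a point that is the value of a variable and of minimal points that are values of
  variables. So the valuation is extended: the new first variable takes the value of \<open>p\<^sub>q\<close>, the old variables follow, shifted
  by one, and the last \<open>h\<close> variables take the values \<open>a\<^sub>T\<close> with \<open>T \<in> snd q\<close>. The new spectrum is
  order-isomorphic to the old one by \<open>pull\<close>. The instance used has \<open>m = h\<close>, as a point below \<open>q\<close> can have
  no minimal points below it other than those of \<open>q\<close>.\<close>
lemma spectrum_fan_below:
  fixes e :: "nat \<Rightarrow> 'a::pdl"
  assumes FS: "\<And>n h (d :: nat \<Rightarrow> 'a). 1 \<le> n \<Longrightarrow> 1 \<le> h \<Longrightarrow> sat d (FS (f h) h (xvars n) (yvars n h))"
    and f: "\<And>h. 1 \<le> h \<Longrightarrow> bij_betw (f h) {1..2^h-1} (Pow {1..h} - {{}})"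
    and q: "q \<in> spectrum N e"
  shows "\<exists>\<zeta>. full_fan (spectrum N e) q \<zeta>"
proof -
  let ?X = "spectrum N e"
  have pts: "r \<in> points N" if "r \<in> ?X" for r using that spectrum_subset_points by blast
  have qp: "q \<in> points N" using pts[OF q] .
  define h where "h = card (snd q)"
  have "finite (Pow {1..N})" "snd q \<subseteq> Pow {1..N}" using qp by (auto simp: points_def)
  then have fin: "finite (snd q)" by (rule finite_subset[rotated])
  have h1: "1 \<le> h" using fin qp by (auto simp: h_def points_def Suc_le_eq card_gt_0_iff)
  obtain \<tau>\<^sub>0 where \<tau>\<^sub>0: "bij_betw \<tau>\<^sub>0 {1..h} (snd q)"
    using ex_bij_betw_nat_finite_1[OF fin] h_def by blast
  have \<tau>\<^sub>0_mem: "\<tau>\<^sub>0 j \<in> snd q" if "j \<in> {1..h}" for j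
    using \<tau>\<^sub>0 that by (auto simp: bij_betw_def)
  have \<tau>\<^sub>0_sub: "\<tau>\<^sub>0 j \<subseteq> {1..N}" if "j \<in> {1..h}" for j
    using \<tau>\<^sub>0_mem[OF that] qp by (auto simp: points_def)
  define n where "n = Suc N"
  define \<sigma> where "\<sigma> i = (if i = 1 then pLT (xvars N) q else if i \<le> n then Var (i - 1)
      else aT (xvars N) (\<tau>\<^sub>0 (i - n)))" for i
  let ?P = "pull (n + h) \<sigma>"
  let ?c = "\<lambda>T. {i\<in>{1..n + h}. forces (\<sigma> i) (T, {T})}"
  have tv: "tvars (\<sigma> i) \<subseteq> {1..N}" if "i \<in> {1..n + h}" for i
  proof -
    have "tvars (pLT (xvars N) q) \<subseteq> {1..N}" by (rule tvars_pLT_points[OF qp])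
    moreover have "tvars (aT (xvars N) (\<tau>\<^sub>0 (i - n))) \<subseteq> {1..N}" if "\<not> i \<le> n"
      using that \<open>i \<in> {1..n + h}\<close> by (intro tvars_aT \<tau>\<^sub>0_sub) auto
    ultimately show ?thesis using that by (auto simp: \<sigma>_def n_def)
  qed
  define d where "d i = tval e (\<sigma> i)" for i
  have X': "spectrum (n + h) d = ?P ` ?X"
    by (rule spectrum_substitution) (use tv in \<open>simp_all add: d_def\<close>)
  \<comment> \<open>The old variables are among the new ones, so the old types can be read off the new ones.\<close>
  have old: "Suc i \<in> {1..n + h}" "forces (\<sigma> (Suc i)) r \<longleftrightarrow> i \<in> fst r" if "i \<in> {1..N}" for i r
    using that by (auto simp: \<sigma>_def n_def)
  have fst_P: "fst r = {i\<in>{1..N}. Suc i \<in> fst (?P r)}" if "r \<in> points N" for r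
    using fst_points[OF that] old(1) old(2)[of _ r] by (auto simp: pull_def)
  have c_old: "{i\<in>{1..N}. Suc i \<in> ?c T} = T" if "T \<subseteq> {1..N}" for T
    using that old(1) old(2)[of _ "(T, {T})"] by auto
  have c_eq: "?c T = ?c T' \<longleftrightarrow> T = T'" if "T \<subseteq> {1..N}" "T' \<subseteq> {1..N}" for T T'
  proof
    assume "?c T = ?c T'"
    then have "{i\<in>{1..N}. Suc i \<in> ?c T} = {i\<in>{1..N}. Suc i \<in> ?c T'}"
      by (rule arg_cong)
    then show "T = T'" unfolding c_old[OF that(1)] c_old[OF that(2)] .
  qed simp
  have snd_sub: "T \<subseteq> {1..N}" if "r \<in> points N" "T \<in> snd r" for r T
    using that by (auto simp: points_def)
  have c_mem: "?c T \<in> snd (?P r) \<longleftrightarrow> T \<in> snd r" if "r \<in> points N" "T \<subseteq> {1..N}" for r T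
  proof
    assume "?c T \<in> snd (?P r)"
    then obtain T' where "T' \<in> snd r" "?c T = ?c T'" by (auto simp: pull_def)
    then show "T \<in> snd r" using c_eq[OF that(2) snd_sub[OF that(1)]] by blast
  qed (simp add: pull_def)
  have le: "SS_le (?P r) (?P s) \<longleftrightarrow> SS_le r s" if r: "r \<in> points N" and s: "s \<in> points N" for r s
  proof
    assume *: "SS_le (?P r) (?P s)"
    then have "fst s \<subseteq> fst r" using fst_P[OF r] fst_P[OF s] by (auto simp: SS_le_iff)
    moreover have "T \<in> snd s" if "T \<in> snd r" for T
    proof -
      have "snd (?P r) \<subseteq> snd (?P s)" using * by (simp add: SS_le_iff)
      then show ?thesis
        using c_mem[OF r snd_sub[OF r that]] c_mem[OF s snd_sub[OF r that]] that by (simp only: subset_iff)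
    qed
    ultimately show "SS_le r s" by (auto simp: SS_le_iff)
  qed (rule pull_mono)
  have P_atom: "?P (T, {T}) = (?c T, {?c T})" for T by (simp add: pull_def)
  have base: "fan_base (?P ` ?X) n h h (?P q) (\<lambda>j. ?c (\<tau>\<^sub>0 j))"
    unfolding fan_base_def
  proof (intro conjI ballI)
    show "?P q \<in> ?P ` ?X" using q by blast
  next
    fix w assume "w \<in> ?P ` ?X"
    then obtain r where r: "r \<in> ?X" "w = ?P r" by blast
    have "1 \<in> fst w \<longleftrightarrow> forces (pLT (xvars N) q) r" by (auto simp: r pull_def \<sigma>_def n_def)
    also have "\<dots> \<longleftrightarrow> SS_le w (?P q)"
      using forces_pLT_points[OF pts[OF r(1)] qp] le[OF pts[OF r(1)] qp] r(2) by simp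
    finally show "1 \<in> fst w \<longleftrightarrow> SS_le w (?P q)" .
  next
    fix j assume j: "j \<in> {1..h}"
    have atom: "(\<tau>\<^sub>0 j, {\<tau>\<^sub>0 j}) \<in> ?X" using atom_in_spectrum[OF q \<tau>\<^sub>0_mem[OF j]] .
    then show "(?c (\<tau>\<^sub>0 j), {?c (\<tau>\<^sub>0 j)}) \<in> ?P ` ?X" using P_atom by (metis imageI)
    show "?c (\<tau>\<^sub>0 j) \<in> snd (?P q) \<longleftrightarrow> j \<le> h"
      using c_mem[OF qp \<tau>\<^sub>0_sub[OF j]] \<tau>\<^sub>0_mem[OF j] j by simp
    fix w assume "w \<in> ?P ` ?X"
    then obtain r where r: "r \<in> ?X" "w = ?P r" by blast
    have "n + j \<in> fst w \<longleftrightarrow> forces (aT (xvars N) (\<tau>\<^sub>0 j)) r"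
      using j by (auto simp: r pull_def \<sigma>_def n_def)
    also have "\<dots> \<longleftrightarrow> r = (\<tau>\<^sub>0 j, {\<tau>\<^sub>0 j})" by (rule forces_aT[OF pts[OF r(1)] \<tau>\<^sub>0_sub[OF j]])
    also have "\<dots> \<longleftrightarrow> w = ?P (\<tau>\<^sub>0 j, {\<tau>\<^sub>0 j})"
      using le[OF pts[OF r(1)] pts[OF atom]] le[OF pts[OF atom] pts[OF r(1)]] r(2)
        SS_le_refl SS_le_antisym by metis
    finally show "n + j \<in> fst w \<longleftrightarrow> w = (?c (\<tau>\<^sub>0 j), {?c (\<tau>\<^sub>0 j)})" unfolding P_atom .
  next
    show "inj_on (\<lambda>j. ?c (\<tau>\<^sub>0 j)) {1..h}"
    proof (rule inj_onI)
      fix i j assume ij: "i \<in> {1..h}" "j \<in> {1..h}" "?c (\<tau>\<^sub>0 i) = ?c (\<tau>\<^sub>0 j)"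
      then have "\<tau>\<^sub>0 i = \<tau>\<^sub>0 j" using c_eq[OF \<tau>\<^sub>0_sub \<tau>\<^sub>0_sub] by blast
      then show "i = j" using \<tau>\<^sub>0 ij by (auto simp: bij_betw_def dest: inj_onD)
    qed
  qed
  have n1: "1 \<le> n" by (simp add: n_def)
  have "sat d (FS (f h) h (xvars n) (yvars n h))" using FS[OF n1 h1] .
  then obtain r' where r': "fan (?P ` ?X) (f h) h h (?P q) (\<lambda>j. ?c (\<tau>\<^sub>0 j)) r'"
    unfolding sat_FS[OF n1 order_refl] X' using base by blast
  let ?K = "{1..2^h-1::nat}"
  have "\<forall>i\<in>?K. \<exists>r\<in>?X. r' i = ?P r" using r' unfolding fan_def by blast
  then obtain r where r: "\<And>i. i \<in> ?K \<Longrightarrow> r i \<in> ?X \<and> r' i = ?P (r i)" by metis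
  have r_le_q: "SS_le (r i) q" if "i \<in> ?K" for i
    using r' r[OF that] that le[OF pts qp] unfolding fan_def by metis
  have r_mono: "SS_le (r i) (r j)" if "i \<in> ?K" "j \<in> ?K" "f h i \<subseteq> f h j" for i j
    using r' r[OF that(1)] r[OF that(2)] that le[OF pts pts] unfolding fan_def by metis
  have r_snd: "\<tau>\<^sub>0 j \<in> snd (r i) \<longleftrightarrow> j \<in> f h i" if i: "i \<in> ?K" and j: "j \<in> {1..h}" for i j
  proof -
    have "?c (\<tau>\<^sub>0 j) \<in> snd (r' i) \<longleftrightarrow> j \<in> f h i" using r' i j unfolding fan_def by blast
    then show ?thesis using c_mem[OF pts \<tau>\<^sub>0_sub[OF j]] r[OF i] by simp
  qed
  \<comment> \<open>The index of \<open>S\<close> is the one that the bijection \<open>f h\<close> sends to the set of positions of \<open>S\<close>.\<close>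
  define idx where "idx S = {j\<in>{1..h}. \<tau>\<^sub>0 j \<in> S}" for S
  define k where "k S = inv_into ?K (f h) (idx S)" for S
  have k: "k S \<in> ?K" "f h (k S) = idx S" if S: "S \<noteq> {}" "S \<subseteq> snd q" for S
  proof -
    have img: "f h ` ?K = Pow {1..h} - {{}}" using f[OF h1] by (simp add: bij_betw_def)
    obtain T where "T \<in> S" "T \<in> snd q" using S by blast
    moreover have "\<tau>\<^sub>0 ` {1..h} = snd q" using \<tau>\<^sub>0 by (simp add: bij_betw_def)
    ultimately obtain j where "j \<in> {1..h}" "\<tau>\<^sub>0 j \<in> S" by (metis imageE)
    then have "idx S \<in> f h ` ?K" unfolding img by (auto simp: idx_def)
    then show "k S \<in> ?K" "f h (k S) = idx S"
      unfolding k_def by (rule inv_into_into, rule f_inv_into_f)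
  qed
  define \<zeta> where "\<zeta> S = r (k S)" for S
  have mem: "\<zeta> S \<in> ?X \<and> SS_le (\<zeta> S) q \<and> snd (\<zeta> S) = S" if S: "S \<noteq> {}" "S \<subseteq> snd q" for S
  proof (intro conjI)
    show "\<zeta> S \<in> ?X" using r[OF k(1)[OF S]] by (simp add: \<zeta>_def)
    show leq: "SS_le (\<zeta> S) q" using r_le_q[OF k(1)[OF S]] by (simp add: \<zeta>_def)
    have "T \<in> snd (\<zeta> S) \<longleftrightarrow> T \<in> S" if T: "T \<in> snd q" for T
    proof -
      obtain j where j: "j \<in> {1..h}" "T = \<tau>\<^sub>0 j" using T \<tau>\<^sub>0 unfolding bij_betw_def by blast
      then show ?thesis
        using r_snd[OF k(1)[OF S] j(1)] k(2)[OF S] by (simp add: \<zeta>_def idx_def)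
    qed
    moreover have "snd (\<zeta> S) \<subseteq> snd q" using leq by (simp add: SS_le_iff)
    ultimately show "snd (\<zeta> S) = S" using S by blast
  qed
  have mono: "SS_le (\<zeta> S) (\<zeta> S')" if "S \<noteq> {}" "S \<subseteq> S'" "S' \<subseteq> snd q" for S S'
  proof -
    have 1: "S \<subseteq> snd q" "S' \<noteq> {}" using that by auto
    have "f h (k S) \<subseteq> f h (k S')"
      unfolding k(2)[OF that(1) 1(1)] k(2)[OF 1(2) that(3)] using that(2) by (auto simp: idx_def)
    then show ?thesis
      unfolding \<zeta>_def by (intro r_mono k(1)[OF that(1) 1(1)] k(1)[OF 1(2) that(3)])
  qed
  have "full_fan ?X q \<zeta>"
    unfolding full_fan_def
  proof (rule conjI; intro allI impI; elim conjE)
  qed (fact mem, fact mono)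
  then show ?thesis by blast
qed

section \<open>Realizing a spectrum in the free algebra\<close>

text \<open>The points \<open>q\<close> of \<open>X\<close> are numbered by \<open>\<nu>\<close> from 1 to \<open>k\<close>, and \<open>M = 2 * k\<close>. The point reserved for \<open>q\<close> has
  first component \<open>{\<nu> q}\<close> and second component the sets \<open>code q T = {\<nu> q, k + \<nu> (T, {T})}\<close> with
  \<open>T \<in> snd q\<close>; both \<open>q\<close> and \<open>T\<close> can be recovered from \<open>code q T\<close>. So the second components belonging to different
  \<open>q\<close> are disjoint, a point lies below at most one reserved point, and \<open>g\<close> can be defined
  independently below each of them. It is monotone across the boundary because every point outside is sent to the
  largest point over its minimal points. Minimal points have to be treated first: they must go
  to minimal points, and the values of the other two clauses need not be minimal over a singleton.\<close>
lemma points_surjection: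
  assumes sub: "X \<subseteq> points N" and ne: "X \<noteq> {}"
    and atoms: "\<And>q T. q \<in> X \<Longrightarrow> T \<in> snd q \<Longrightarrow> (T, {T}) \<in> X"
    and z: "\<And>S. S \<noteq> {} \<Longrightarrow> S \<subseteq> {T. (T, {T}) \<in> X} \<Longrightarrow>
      \<exists>z\<in>X. snd z = S \<and> (\<forall>q\<in>X. snd q \<subseteq> S \<longrightarrow> SS_le q z)"
    and fans: "\<And>q. q \<in> X \<Longrightarrow> \<exists>\<zeta>. full_fan X q \<zeta>"
  shows "\<exists>M c g. g ` points M = X \<and>
    (\<forall>p\<in>points M. \<forall>p'\<in>points M. SS_le p p' \<longrightarrow> SS_le (g p) (g p')) \<and>
    (\<forall>p\<in>points M. snd (g p) = c ` snd p) \<and> (\<forall>T. g (T, {T}) = (c T, {c T}))"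
proof -
  have pts: "q \<in> points N" if "q \<in> X" for q using sub that by blast
  have snd_ne: "snd q \<noteq> {}" if "q \<in> X" for q using pts[OF that] by (simp add: points_def)
  define top_over where "top_over S = (SOME z. z \<in> X \<and> snd z = S \<and> (\<forall>q\<in>X. snd q \<subseteq> S \<longrightarrow> SS_le q z))" for S
  have top_over: "top_over S \<in> X" "snd (top_over S) = S" "\<And>q. q \<in> X \<Longrightarrow> snd q \<subseteq> S \<Longrightarrow> SS_le q (top_over S)"
    if "S \<noteq> {}" "S \<subseteq> {T. (T, {T}) \<in> X}" for S
  proof -
    have "\<exists>z. z \<in> X \<and> snd z = S \<and> (\<forall>q\<in>X. snd q \<subseteq> S \<longrightarrow> SS_le q z)" using z[OF that] by blast
    from someI_ex[OF this] show "top_over S \<in> X" "snd (top_over S) = S"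
      "\<And>q. q \<in> X \<Longrightarrow> snd q \<subseteq> S \<Longrightarrow> SS_le q (top_over S)" unfolding top_over_def by blast+
  qed
  have "\<forall>q\<in>X. \<exists>\<zeta>. full_fan X q \<zeta>" using fans by blast
  from bchoice[OF this] obtain \<zeta>\<^sub>0 where full: "\<And>q. q \<in> X \<Longrightarrow> full_fan X q (\<zeta>\<^sub>0 q)" by blast
  have \<zeta>\<^sub>0: "\<zeta>\<^sub>0 q S \<in> X \<and> SS_le (\<zeta>\<^sub>0 q S) q \<and> snd (\<zeta>\<^sub>0 q S) = S"
    if "q \<in> X" "S \<noteq> {}" "S \<subseteq> snd q" for q S
    using full[OF that(1)] that(2,3) unfolding full_fan_def by blast
  have \<zeta>\<^sub>0_mono: "SS_le (\<zeta>\<^sub>0 q S) (\<zeta>\<^sub>0 q S')"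
    if "q \<in> X" "S \<noteq> {}" "S \<subseteq> S'" "S' \<subseteq> snd q" for q S S'
    using full[OF that(1), unfolded full_fan_def, THEN conjunct2, rule_format, of S S'] that(2-4) by simp
  \<comment> \<open>A fan may be changed at its top so that \<open>q\<close> itself is a member.\<close>
  define \<zeta> where "\<zeta> q S = (if S = snd q then q else \<zeta>\<^sub>0 q S)" for q S
  have \<zeta>: "\<zeta> q S \<in> X" "snd (\<zeta> q S) = S" if "q \<in> X" "S \<noteq> {}" "S \<subseteq> snd q" for q S
    using \<zeta>\<^sub>0[OF that] that by (simp_all add: \<zeta>_def)
  have \<zeta>_mono: "SS_le (\<zeta> q S) (\<zeta> q S')" if "q \<in> X" "S \<noteq> {}" "S \<subseteq> S'" "S' \<subseteq> snd q" for q S S'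
  proof (cases "S = snd q")
    case True
    then have "S' = snd q" using that by blast
    then show ?thesis using True by (simp add: \<zeta>_def)
  next
    case False
    moreover have "S \<subseteq> snd q" using that by blast
    ultimately show ?thesis
      using \<zeta>\<^sub>0[OF that(1,2)] \<zeta>\<^sub>0_mono[OF that] by (simp add: \<zeta>_def)
  qed
  have "finite X" using sub finite_points by (rule finite_subset)
  then obtain \<nu> :: "point \<Rightarrow> nat" where \<nu>: "bij_betw \<nu> X {1..card X}"
    using ex_bij_betw_finite_nat bij_betw_iff_card[of X "{1..card X}"] by auto
  have \<nu>_inj: "\<nu> p = \<nu> q \<longleftrightarrow> p = q" if "p \<in> X" "q \<in> X" for p q
    using \<nu> that by (auto simp: bij_betw_def inj_on_def)
  have \<nu>_range: "\<nu> q \<in> {1..card X}" if "q \<in> X" for q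
    using \<nu> that by (auto simp: bij_betw_def)
  define k where "k = card X"
  define M where "M = 2 * k"
  define code where "code q T = {\<nu> q, k + \<nu> (T, {T})}" for q T
  have code_inj: "code q T = code q' T' \<longleftrightarrow> q = q' \<and> T = T'"
    if "q \<in> X" "q' \<in> X" "T \<in> snd q" "T' \<in> snd q'" for q q' T T'
  proof
    assume "code q T = code q' T'"
    then have "\<nu> q = \<nu> q'" "\<nu> (T, {T}) = \<nu> (T', {T'})"
      using \<nu>_range[OF that(1)] \<nu>_range[OF that(2)]
        \<nu>_range[OF atoms[OF that(1,3)]] \<nu>_range[OF atoms[OF that(2,4)]]
      by (auto simp: code_def doubleton_eq_iff k_def)
    then show "q = q' \<and> T = T'"
      using \<nu>_inj[OF that(1,2)] \<nu>_inj[OF atoms[OF that(1,3)] atoms[OF that(2,4)]] by simp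
  qed simp
  have code_sub: "code q T \<subseteq> {1..M}" if "q \<in> X" "T \<in> snd q" for q T
    using \<nu>_range[OF that(1)] \<nu>_range[OF atoms[OF that]] by (auto simp: code_def M_def k_def)
  obtain T\<^sub>0 where T\<^sub>0: "(T\<^sub>0, {T\<^sub>0}) \<in> X" using ne snd_ne atoms by blast
  \<comment> \<open>The action on minimal points decodes \<open>code q T\<close> to \<open>T\<close>; the value \<open>T\<^sub>0\<close> elsewhere is arbitrary.\<close>
  define c where "c U = (if \<exists>q T. q \<in> X \<and> T \<in> snd q \<and> U = code q T
    then SOME T. \<exists>q. q \<in> X \<and> T \<in> snd q \<and> U = code q T else T\<^sub>0)" for U
  have c_code: "c (code q T) = T" if "q \<in> X" "T \<in> snd q" for q T
  proof -
    have ex: "\<exists>q' T'. q' \<in> X \<and> T' \<in> snd q' \<and> code q T = code q' T'" using that by blast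
    have "(SOME T'. \<exists>q'. q' \<in> X \<and> T' \<in> snd q' \<and> code q T = code q' T') = T"
    proof (rule some_equality)
      show "\<exists>q'. q' \<in> X \<and> T \<in> snd q' \<and> code q T = code q' T" using that by blast
      fix T' assume "\<exists>q'. q' \<in> X \<and> T' \<in> snd q' \<and> code q T = code q' T'"
      then show "T' = T" using code_inj that by blast
    qed
    then show ?thesis using ex by (simp add: c_def)
  qed
  have c_atom: "(c U, {c U}) \<in> X" for U
  proof (cases "\<exists>q T. q \<in> X \<and> T \<in> snd q \<and> U = code q T")
    case True
    then obtain q T where "q \<in> X" "T \<in> snd q" "U = code q T" by blast
    then show ?thesis using c_code atoms by simp
  next
    case False
    then have "c U = T\<^sub>0" unfolding c_def by (rule if_not_P)
    then show ?thesis using T\<^sub>0 by simp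
  qed
  \<comment> \<open>\<open>below q p\<close> says that \<open>p\<close> lies below the point reserved for \<open>q\<close>.\<close>
  define below where "below q p \<longleftrightarrow> q \<in> X \<and> \<nu> q \<in> fst p \<and> snd p \<subseteq> code q ` snd q" for q p
  have below_unique: "q = q'" if "below q p" "below q' p" "p \<in> points M" for q q' p
  proof -
    have "snd p \<noteq> {}" using that(3) by (simp add: points_def)
    then obtain U where "U \<in> snd p" by blast
    then obtain T T' where "T \<in> snd q" "T' \<in> snd q'" "code q T = code q' T'"
      using \<open>below q p\<close> \<open>below q' p\<close> unfolding below_def by blast
    moreover have "q \<in> X" "q' \<in> X" using that by (simp_all add: below_def)
    ultimately show ?thesis using code_inj[of q q' T T'] by simp
  qed
  have below_down: "below q p" if "below q p'" "SS_le p p'" for q p p'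
    using that by (auto simp: below_def SS_le_iff)
  have below_snd: "c ` snd p \<subseteq> snd q" if "below q p" for q p
  proof
    fix T assume "T \<in> c ` snd p"
    then obtain U where U: "U \<in> snd p" "T = c U" by blast
    then obtain T' where "T' \<in> snd q" "U = code q T'"
      using \<open>below q p\<close> by (auto simp: below_def)
    then show "T \<in> snd q" using U that c_code by (simp add: below_def)
  qed
  define g where "g p = (if snd p = {fst p} then (c (fst p), {c (fst p)})
    else if \<exists>q. below q p then \<zeta> (THE q. below q p) (c ` snd p)
    else top_over (c ` snd p))" for p
  have g_atom: "g (T, {T}) = (c T, {c T})" for T by (simp add: g_def)
  have g_below: "g p = \<zeta> q (c ` snd p)"
    if "snd p \<noteq> {fst p}" "below q p" "p \<in> points M" for p q
  proof -
    have the: "(THE q. below q p) = q"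
      by (rule the_equality) (fact that(2), rule below_unique[OF _ that(2,3)])
    have "\<exists>q. below q p" using that(2) by (rule exI)
    then show ?thesis unfolding g_def if_not_P[OF that(1)] the by (rule if_P)
  qed
  have g_top: "g p = top_over (c ` snd p)"
    if "snd p \<noteq> {fst p}" "\<not> (\<exists>q. below q p)" for p
    using that by (simp add: g_def)
  have c_snd: "c ` snd p \<noteq> {}" "c ` snd p \<subseteq> {T. (T, {T}) \<in> X}" if "p \<in> points M" for p
    using that c_atom by (auto simp: points_def)
  have g_X: "g p \<in> X \<and> snd (g p) = c ` snd p" if p: "p \<in> points M" for p
  proof -
    consider "snd p = {fst p}" | q where "snd p \<noteq> {fst p}" "below q p"
      | "snd p \<noteq> {fst p}" "\<not> (\<exists>q. below q p)" by blast
    then show ?thesis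
    proof cases
      case 1
      then show ?thesis using c_atom by (simp add: g_def)
    next
      case 2
      then have "q \<in> X" by (simp add: below_def)
      then show ?thesis
        unfolding g_below[OF 2 p] using \<zeta>[OF _ c_snd(1)[OF p] below_snd[OF 2(2)]] by simp
    next
      case 3
      show ?thesis unfolding g_top[OF 3] using top_over[OF c_snd[OF p]] by simp
    qed
  qed
  have g_mono: "SS_le (g p) (g p')" if p: "p \<in> points M" and p': "p' \<in> points M" and le: "SS_le p p'" for p p'
  proof -
    have snd_le: "c ` snd p \<subseteq> c ` snd p'" using le by (auto simp: SS_le_iff)
    consider "snd p = {fst p}" | "snd p \<noteq> {fst p}" "snd p' = {fst p'}"
      | q where "snd p \<noteq> {fst p}" "snd p' \<noteq> {fst p'}" "below q p'"
      | "snd p \<noteq> {fst p}" "snd p' \<noteq> {fst p'}" "\<not> (\<exists>q. below q p')" by blast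
    then show ?thesis
    proof cases
      case 1
      then have gp: "g p = (c (fst p), {c (fst p)})" by (simp add: g_def)
      have "c (fst p) \<in> snd (g p')" using g_X[OF p'] snd_le 1 by simp
      then show ?thesis unfolding gp using g_X[OF p'] pts atom_le by blast
    next
      case 2
      then have "p' = (fst p', {fst p'})" by (metis prod.collapse)
      then have "p = p'" using le le_atom[OF p, of "fst p'"] by simp
      then show ?thesis by simp
    next
      case 3
      have q: "q \<in> X" using 3(3) by (simp add: below_def)
      show ?thesis
        unfolding g_below[OF 3(1) below_down[OF 3(3) le] p] g_below[OF 3(2,3) p']
        by (rule \<zeta>_mono[OF q c_snd(1)[OF p] snd_le below_snd[OF 3(3)]])
    next
      case 4
      show ?thesis
        unfolding g_top[OF 4(2,3)] using top_over(3)[OF c_snd[OF p'], of "g p"] g_X[OF p] snd_le by simp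
    qed
  qed
  have "q \<in> g ` points M" if q: "q \<in> X" for q
  proof (rule image_eqI)
    let ?p = "({\<nu> q}, code q ` snd q)"
    show p: "?p \<in> points M"
      using snd_ne[OF q] code_sub[OF q] by (auto simp: points_def code_def)
    have "code q T \<noteq> {\<nu> q}" if "T \<in> snd q" for T
      using \<nu>_range[OF q] \<nu>_range[OF atoms[OF q that]] by (auto simp: code_def k_def)
    moreover obtain T where "T \<in> snd q" using snd_ne[OF q] by blast
    ultimately have 1: "snd ?p \<noteq> {fst ?p}" by auto
    have 2: "below q ?p" using q by (simp add: below_def)
    have "c ` snd ?p = snd q" using c_code[OF q] by (simp add: image_image)
    then show "q = g ?p" unfolding g_below[OF 1 2 p] by (simp add: \<zeta>_def)
  qed
  then have "X \<subseteq> g ` points M" by blast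
  moreover have "g ` points M \<subseteq> X" using g_X by blast
  ultimately have "g ` points M = X" by (rule subset_antisym[rotated])
  moreover have "\<forall>p\<in>points M. \<forall>p'\<in>points M. SS_le p p' \<longrightarrow> SS_le (g p) (g p')"
    using g_mono by blast
  moreover have "\<forall>p\<in>points M. snd (g p) = c ` snd p" using g_X by blast
  moreover have "\<forall>T. g (T, {T}) = (c T, {c T})" using g_atom by blast
  ultimately show ?thesis by (intro exI[of _ M] exI[of _ c] exI[of _ g] conjI)
qed

text \<open>Each set \<open>U i\<close> of points \<open>p\<close> with \<open>i \<in> fst (g p)\<close> is a down-set of \<open>points M\<close>, hence defined by a join of terms \<open>p\<^sub>r\<close>.
  Substituting these joins for the variables induces \<open>g\<close>.\<close>
lemma spectrum_of_monotone_map: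
  assumes mono: "\<forall>p\<in>points M. \<forall>p'\<in>points M. SS_le p p' \<longrightarrow> SS_le (g p) (g p')"
    and snd: "\<forall>p\<in>points M. snd (g p) = c ` snd p"
    and atom: "\<forall>T. g (T, {T}) = (c T, {c T})"
    and range: "g ` points M \<subseteq> points N"
  shows "\<exists>d :: nat \<Rightarrow> free_pdl. spectrum N d = g ` points M"
proof -
  define U where "U i = {p\<in>points M. i \<in> fst (g p)}" for i
  define \<sigma> where "\<sigma> i = Joins (U i) (pLT (xvars M))" for i
  have fin: "finite (U i)" for i unfolding U_def using finite_points by simp
  have tv: "tvars (\<sigma> i) \<subseteq> {1..M}" for i
  proof -
    have "tvars (pLT (xvars M) p) \<subseteq> {1..M}" if "p \<in> U i" for p
      using that by (intro tvars_pLT_points) (simp add: U_def)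
    then show ?thesis unfolding \<sigma>_def tvars_Joins[OF fin] by blast
  qed
  have f: "forces (\<sigma> i) p \<longleftrightarrow> i \<in> fst (g p)" if p: "p \<in> points M" for i p
  proof -
    have "forces (\<sigma> i) p \<longleftrightarrow> (\<exists>r\<in>U i. SS_le p r)"
      unfolding \<sigma>_def forces_Joins[OF fin] using forces_pLT_points[OF p] by (auto simp: U_def)
    also have "\<dots> \<longleftrightarrow> i \<in> fst (g p)"
    proof
      assume "\<exists>r\<in>U i. SS_le p r"
      then obtain r where r: "r \<in> points M" "i \<in> fst (g r)" "SS_le p r" by (auto simp: U_def)
      then have "SS_le (g p) (g r)" using mono p by blast
      then show "i \<in> fst (g p)" using r(2) by (auto simp: SS_le_iff)
    next
      assume "i \<in> fst (g p)"
      then have "p \<in> U i" using p by (simp add: U_def)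
      then show "\<exists>r\<in>U i. SS_le p r" using SS_le_refl by blast
    qed
    finally show ?thesis .
  qed
  have "pull N \<sigma> p = g p" if p: "p \<in> points M" for p
  proof (rule prod_eqI)
    have gp: "g p \<in> points N" using range p by blast
    show "fst (pull N \<sigma> p) = fst (g p)"
      using f[OF p] fst_points[OF gp] by (auto simp: pull_def)
    have "{i\<in>{1..N}. forces (\<sigma> i) (T, {T})} = c T" if T: "T \<in> snd p" for T
    proof -
      have Tp: "(T, {T}) \<in> points M" using atom_in_points[OF p T] .
      have g: "g (T, {T}) = (c T, {c T})" using atom by blast
      have "g (T, {T}) \<in> points N" using range Tp by blast
      from fst_points[OF this] show ?thesis unfolding f[OF Tp] g by auto
    qed
    then show "snd (pull N \<sigma> p) = snd (g p)"
      using snd p by (simp add: pull_def)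
  qed
  then have "pull N \<sigma> ` points M = g ` points M" by (rule image_cong[OF HOL.refl])
  moreover have "spectrum N (\<lambda>i. tval gen (\<sigma> i)) = pull N \<sigma> ` spectrum M gen"
    using tv by (intro spectrum_substitution) auto
  ultimately show ?thesis unfolding spectrum_gen by metis
qed

lemma free_valuation_with_spectrum:
  fixes e :: "nat \<Rightarrow> 'a::pdl"
  assumes nontriv: "(bot :: 'a) \<noteq> top"
    and DN: "\<And>x y z :: 'a. - (- x) = sup y z \<Longrightarrow> y = - (- x) \<or> z = - (- x)"
    and FS: "\<And>n h (d :: nat \<Rightarrow> 'a). 1 \<le> n \<Longrightarrow> 1 \<le> h \<Longrightarrow> sat d (FS (f h) h (xvars n) (yvars n h))"
    and f: "\<And>h. 1 \<le> h \<Longrightarrow> bij_betw (f h) {1..2^h-1} (Pow {1..h} - {{}})"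
  shows "\<exists>d :: nat \<Rightarrow> free_pdl. spectrum N d = spectrum N e"
proof -
  have "\<not> (top :: 'a) \<le> bot" using nontriv by (simp add: top_unique bot_unique)
  then obtain P :: "'a set" where "prime_filter P" by (rule prime_filter_separates)
  then have ne: "spectrum N e \<noteq> {}" by (auto simp: spectrum_def)
  have "\<exists>M c g. g ` points M = spectrum N e \<and>
    (\<forall>p\<in>points M. \<forall>p'\<in>points M. SS_le p p' \<longrightarrow> SS_le (g p) (g p')) \<and>
    (\<forall>p\<in>points M. snd (g p) = c ` snd p) \<and> (\<forall>T. g (T, {T}) = (c T, {c T}))"
    by (rule points_surjection[OF spectrum_subset_points ne atom_in_spectrum
          spectrum_greatest_over[OF DN] spectrum_fan_below[OF FS f]])
  then obtain M c g where g: "g ` points M = spectrum N e"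
    "\<forall>p\<in>points M. \<forall>p'\<in>points M. SS_le p p' \<longrightarrow> SS_le (g p) (g p')"
    "\<forall>p\<in>points M. snd (g p) = c ` snd p" "\<forall>T. g (T, {T}) = (c T, {c T})"
    by (elim exE conjE)
  show ?thesis
    using spectrum_of_monotone_map[OF g(2-4), of N] g(1) spectrum_subset_points[of N e] by simp
qed

text \<open>Formulas may use the variable 0, which spectra ignore; hence the shift of the variables by one on both
  sides.\<close>
lemma sat_free_if_same_spectrum:
  fixes e :: "nat \<Rightarrow> 'a::pdl" and d :: "nat \<Rightarrow> free_pdl"
  assumes "spectrum N d = spectrum N (\<lambda>i. e (i - 1))" "qfree \<phi>" "fvars \<phi> \<subseteq> {..<N}"
  shows "sat (\<lambda>i. d (Suc i)) \<phi> \<longleftrightarrow> sat e \<phi>"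
proof (rule sat_cong[OF _ assms(2,3)])
  fix s t assume st: "tvars s \<subseteq> {..<N}" "tvars t \<subseteq> {..<N}"
  have tv: "tvars (shift u) \<subseteq> {1..N}" if "tvars u \<subseteq> {..<N}" for u
    using that by (auto simp: tvars_shift)
  have e: "tval e u = tval (\<lambda>i. e (i - 1)) (shift u)" for u by (simp add: tval_subst)
  have d: "tval (\<lambda>i. d (Suc i)) u = tval d (shift u)" for u by (simp add: tval_subst)
  show "tval (\<lambda>i. d (Suc i)) s = tval (\<lambda>i. d (Suc i)) t \<longleftrightarrow> tval e s = tval e t"
    unfolding e d tval_eq_iff_spectrum[OF tv[OF st(1)] tv[OF st(2)]] assms(1) ..
qed

lemma DN_algebraic:
  assumes "models TYPE('a::pdl) (universal_closure (DN (Var 1) (Var 2) (Var 3)))"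
    and eq: "- (- x) = sup y (z :: 'a)"
  shows "y = - (- x) \<or> z = - (- x)"
proof -
  have "sat ((\<lambda>_. x)(2 := y, 3 := z)) (DN (Var 1) (Var 2) (Var 3))"
    using assms(1) unfolding models_universal_closure by blast
  then show ?thesis using eq by (simp add: DN_def)
qed

theorem theorem7p13:
  fixes f :: "nat \<Rightarrow> nat \<Rightarrow> nat set" and A :: "'a::pdl itself"
  assumes "\<And>h. 1 \<le> h \<Longrightarrow> bij_betw (f h) {1..2^h-1} (Pow {1..h} - {{}})"
  shows "models_set A (Th_univ TYPE(free_pdl)) \<longleftrightarrow> models_set A (Sigma_axioms f)"
proof
  assume "models_set A (Th_univ TYPE(free_pdl))"
  then show "models_set A (Sigma_axioms f)"
    using Sigma_axioms_in_Th_free[OF assms] unfolding models_set_def by blast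
next
  assume ax: "models_set A (Sigma_axioms f)"
  have A: "models_set A \<Gamma> \<longleftrightarrow> (\<forall>\<phi>\<in>\<Gamma>. models TYPE('a) \<phi>)" for \<Gamma>
    by (simp add: models_set_def models_def)
  have "universal_closure (NOT (EQ Zero One)) \<in> Sigma_axioms f"
    "universal_closure (DN (Var 1) (Var 2) (Var 3)) \<in> Sigma_axioms f"
    by (simp_all add: Sigma_axioms_def)
  then have m: "models TYPE('a) (universal_closure (NOT (EQ Zero One)))"
    "models TYPE('a) (universal_closure (DN (Var 1) (Var 2) (Var 3)))"
    using ax unfolding A by blast+
  have nontriv: "(bot :: 'a) \<noteq> top" using m(1) by (simp add: models_universal_closure)
  have FS: "sat d (FS (f h) h (xvars n) (yvars n h))" if "1 \<le> n" "1 \<le> h" for n h and d :: "nat \<Rightarrow> 'a"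
  proof -
    have "universal_closure (FS (f h) h (xvars n) (yvars n h)) \<in> Sigma_axioms f"
      unfolding Sigma_axioms_def using that by blast
    then have "models TYPE('a) (universal_closure (FS (f h) h (xvars n) (yvars n h)))"
      using ax unfolding A by blast
    then show ?thesis by (simp add: models_universal_closure)
  qed
  show "models_set A (Th_univ TYPE(free_pdl))"
    unfolding A
  proof
    fix \<phi> assume \<phi>: "\<phi> \<in> Th_univ TYPE(free_pdl)"
    then obtain "is" P where P: "qfree P" "\<phi> = foralls is P"
      by (auto simp: Th_univ_def universal_sentence_def)
    have free: "sat d P" for d :: "nat \<Rightarrow> free_pdl"
      using \<phi> sat_foralls[where 'a = free_pdl, of "is" P] unfolding P(2) Th_univ_def models_def by blast
    obtain N where N: "fvars P \<subseteq> {..<N}"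
      using finite_fvars[of P] unfolding finite_nat_set_iff_bounded by blast
    have "sat e P" for e :: "nat \<Rightarrow> 'a"
    proof -
      obtain d :: "nat \<Rightarrow> free_pdl" where "spectrum N d = spectrum N (\<lambda>i. e (i - 1))"
        using free_valuation_with_spectrum[OF nontriv DN_algebraic[OF m(2)] FS assms] by blast
      from sat_free_if_same_spectrum[OF this P(1) N] free show ?thesis by blast
    qed
    then show "models TYPE('a) \<phi>"
      using sat_foralls[where 'a = 'a, of "is" P] unfolding P(2) models_def by blast
  qed
qed

end
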